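(* Let $n\ge 1$, let $H\in C(\mathbb{R}^n)$ be an arbitrary continuous function, let $u_0\in AP(\mathbb{R}^n)$, and let $M_0$ be the smallest additive subgroup of $\mathbb{R}^n$ containing $Sp(u_0)$. Let $u(t,x)$ be the unique viscosity solution of the Cauchy problem $$u_t+H(\nabla_x u)=0 \ \text{ in } \Pi=(0,+\infty)\times\mathbb{R}^n,\qquad u(0,x)=u_0(x).$$ Then $u(t,\cdot)\in C([0,+\infty),AP(\mathbb{R}^n))$, and for all $t>0$ one has $Sp(u(t,\cdot))\subset M_0$.
   Context: Function spaces. $BUC(\mathbb{R}^n)$ is the Banach space of bounded uniformly continuous functions on $\mathbb{R}^n$ with the uniform norm $\|\cdot\|_\infty$. $BUC_{loc}(\bar\Pi)$, $\bar\Pi=[0,+\infty)\times\mathbb{R}^n$, is the space of continuous functions on $\bar\Pi$ that are bounded and uniformly continuous in each layer $[0,T)\times\mathbb{R}^n$, $T>0$. Viscosity solutions. For $u\in C(\Pi)$, $D^+u(t_0,x_0)$ (respectively $D^-u(t_0,x_0)$) is the set of all vectors $\nabla\varphi(t_0,x_0)=(\varphi_t(t_0,x_0),\nabla_x\varphi(t_0,x_0))\in\mathbb{R}\times\mathbb{R}^n$ where $\varphi\in C^1(\Pi)$ and $(t_0,x_0)$ is a point of local maximum (respectively local minimum) of $u-\varphi$. A function $u\in BUC_{loc}(\bar\Pi)$ is a viscosity subsolution of the problem $u_t+H(\nabla_x u)=0$, $u(0,x)=u_0(x)$ if $u(0,x)\le u_0(x)$ for all $x$ and $s+H(p)\le 0$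 for all $(s,p)\in D^+u(t,x)$, $(t,x)\in\Pi$; it is a viscosity supersolution if $u(0,x)\ge u_0(x)$ for all $x$ and $s+H(p)\ge 0$ for all $(s,p)\in D^-u(t,x)$, $(t,x)\in\Pi$; it is a viscosity solution if it is both. It is known that for each $u_0\in BUC(\mathbb{R}^n)$ there is a unique viscosity solution. Almost periodic functions. $AP(\mathbb{R}^n)$ is the space of Bohr almost periodic functions, i.e. the closure in $BUC(\mathbb{R}^n)$ of the trigonometric polynomials (finite sums $\sum a_\lambda e^{2\pi i\lambda\cdot x}$, $\lambda\in\mathbb{R}^n$), equipped with the uniform norm. For $u\in AP(\mathbb{R}^n)$ the Bohr-Fourier coefficients are $a_\lambda=\lim_{R\to+\infty}R^{-n}\int_{C_R}u(x)e^{-2\pi i\lambda\cdot x}\,dx$, $\lambda\in\mathbb{R}^n$, where $C_R=\{x\in\mathbb{R}^n: \max_i|x_i|\le R/2\}$, and the spectrum is $Sp(u)=\{\lambda\in\mathbb{R}^n: a_\lambda\neq 0\}$. The solution $u$ and the initial function $u_0$ are real-valued. The notation $u(t,\cdot)\in C([0,+\infty),AP(\mathbb{R}^n))$ means that $t\mapsto u(t,\cdot)$ is a continuous map from $[0,+\infty)$ to $AP(\mathbb{R}^n)$ with the uniform norm. *)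

theory Defs
  imports "HOL-Analysis.Analysis" "HOL-Computational_Algebra.Group_Closure"
begin

subsection \<open>Function spaces\<close>

definition BUC :: "('a::metric_space \<Rightarrow>\<^sub>C 'b::metric_space) set"
  where "BUC = {f. uniformly_continuous_on UNIV (apply_bcontfun f)}"

definition open_half_space :: "(real \<times> (real^'n)) set"
  where "open_half_space = {0<..} \<times> UNIV"

definition closed_half_space :: "(real \<times> (real^'n)) set"
  where "closed_half_space = {0..} \<times> UNIV"

text \<open>Functions on the closed half-space are total functions in HOL; their values at negative
  times never matter.\<close>

definition BUC_loc :: "(real \<times> (real^'n) \<Rightarrow> real) set"
  where "BUC_loc = {u. continuous_on closed_half_space u \<and>
    (\<forall>T>0. bounded (u ` ({0..<T} \<times> UNIV)) \<and> uniformly_continuous_on ({0..<T} \<times> UNIV) u)}"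


subsection \<open>Viscosity solutions\<close>

text \<open>\<open>C1_with_gradient S \<phi> G\<close>: the function \<open>\<phi>\<close> is continuously differentiable on the open set
  \<open>S\<close>, with gradient \<open>G\<close>.\<close>

definition C1_with_gradient :: "'a::real_inner set \<Rightarrow> ('a \<Rightarrow> real) \<Rightarrow> ('a \<Rightarrow> 'a) \<Rightarrow> bool"
  where "C1_with_gradient S \<phi> G \<longleftrightarrow> (\<forall>z\<in>S. GDERIV \<phi> z :> G z) \<and> continuous_on S G"

definition superdifferential ::
    "(real \<times> (real^'n) \<Rightarrow> real) \<Rightarrow> real \<times> (real^'n) \<Rightarrow> (real \<times> (real^'n)) set"
  where "superdifferential u z =
    {G z | \<phi> G. C1_with_gradient open_half_space \<phi> G \<and>
      (\<forall>\<^sub>F w in at z within open_half_space. u w - \<phi> w \<le> u z - \<phi> z)}"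

definition subdifferential ::
    "(real \<times> (real^'n) \<Rightarrow> real) \<Rightarrow> real \<times> (real^'n) \<Rightarrow> (real \<times> (real^'n)) set"
  where "subdifferential u z =
    {G z | \<phi> G. C1_with_gradient open_half_space \<phi> G \<and>
      (\<forall>\<^sub>F w in at z within open_half_space. u w - \<phi> w \<ge> u z - \<phi> z)}"

definition viscosity_subsolution ::
    "(real^'n \<Rightarrow> real) \<Rightarrow> (real^'n \<Rightarrow> real) \<Rightarrow> (real \<times> (real^'n) \<Rightarrow> real) \<Rightarrow> bool"
  where "viscosity_subsolution H u0 u \<longleftrightarrow> u \<in> BUC_loc \<and> (\<forall>x. u (0, x) \<le> u0 x) \<and>
    (\<forall>z\<in>open_half_space. \<forall>(s, p)\<in>superdifferential u z. s + H p \<le> 0)"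

definition viscosity_supersolution ::
    "(real^'n \<Rightarrow> real) \<Rightarrow> (real^'n \<Rightarrow> real) \<Rightarrow> (real \<times> (real^'n) \<Rightarrow> real) \<Rightarrow> bool"
  where "viscosity_supersolution H u0 u \<longleftrightarrow> u \<in> BUC_loc \<and> (\<forall>x. u (0, x) \<ge> u0 x) \<and>
    (\<forall>z\<in>open_half_space. \<forall>(s, p)\<in>subdifferential u z. s + H p \<ge> 0)"

definition viscosity_solution ::
    "(real^'n \<Rightarrow> real) \<Rightarrow> (real^'n \<Rightarrow> real) \<Rightarrow> (real \<times> (real^'n) \<Rightarrow> real) \<Rightarrow> bool"
  where "viscosity_solution H u0 u \<longleftrightarrow>
    viscosity_subsolution H u0 u \<and> viscosity_supersolution H u0 u"


subsection \<open>Bohr almost periodic functions\<close>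

definition trig_polys :: "((real^'n) \<Rightarrow>\<^sub>C complex) set"
  where "trig_polys = {f. \<exists>\<Lambda> a. finite \<Lambda> \<and>
    (\<forall>x. apply_bcontfun f x = (\<Sum>\<xi>\<in>\<Lambda>. a \<xi> * cis (2 * pi * (\<xi> \<bullet> x))))}"

definition AP :: "((real^'n) \<Rightarrow>\<^sub>C complex) set"
  where "AP = top_of_set BUC closure_of trig_polys"

definition centered_cube :: "real \<Rightarrow> (real^'n) set"
  where "centered_cube R = {x. \<forall>i. \<bar>x $ i\<bar> \<le> R / 2}"

definition bohr_coeff :: "((real^'n) \<Rightarrow>\<^sub>C complex) \<Rightarrow> real^'n \<Rightarrow> complex"
  where "bohr_coeff f \<xi> = Lim at_top
    (\<lambda>R. integral (centered_cube R) (\<lambda>x. apply_bcontfun f x * cis (- (2 * pi * (\<xi> \<bullet> x))))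
           /\<^sub>R R ^ CARD('n))"

definition bohr_spectrum :: "((real^'n) \<Rightarrow>\<^sub>C complex) \<Rightarrow> (real^'n) set"
  where "bohr_spectrum f = {\<xi>. bohr_coeff f \<xi> \<noteq> 0}"

text \<open>Real-valued functions are regarded as elements of the complex space of almost periodic
  functions via the isometric embedding of the real into the complex numbers.\<close>

definition complexify :: "('a::topological_space \<Rightarrow>\<^sub>C real) \<Rightarrow> ('a \<Rightarrow>\<^sub>C complex)"
  where "complexify f = Bcontfun (\<lambda>x. complex_of_real (apply_bcontfun f x))"

lemma apply_bcontfun_complexify [simp]:
  "apply_bcontfun (complexify f) x = complex_of_real (apply_bcontfun f x)"
proof -
  have "(\<lambda>x. complex_of_real (apply_bcontfun f x)) \<in> bcontfun"
    using bounded_apply_bcontfun[of f]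
    by (auto simp: bcontfun_def bounded_iff intro!: continuous_intros)
  then show ?thesis
    by (simp add: complexify_def Bcontfun_inverse)
qed

end

theory Submission
  imports Defs
begin

text \<open>
  The equation contains neither \<open>x\<close> nor \<open>u\<close> itself, so it is invariant under translations in \<open>x\<close>
  and under the addition of constants. The comparison principle \<open>viscosity_comparison\<close> therefore
  shows that translating \<open>u (t, \<cdot>)\<close> by \<open>h\<close> changes it, in the uniform norm, by at most as much
  as translating \<open>u0\<close> by \<open>h\<close> changes \<open>u0\<close>; this is \<open>viscosity_solution_translation_stable\<close>.
  The comparison principle is proved by doubling the variables. As \<open>H\<close> is only continuous, the
  penalisation at infinity is made small after the other penalties have been fixed: the gradients then
  stay in a fixed ball, on which \<open>H\<close> is uniformly continuous.

  What remains is a statement about almost periodic functions, \<open>translation_dominated_trig_approx\<close>: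
  if \<open>\<bar>g x - g y\<bar>\<close> is at most the distance of the translates of an almost periodic function \<open>f\<close> by
  \<open>x\<close> and by \<open>y\<close>, then \<open>g\<close> is a uniform limit of trigonometric polynomials with frequencies in
  the group generated by the spectrum of \<open>f\<close>. Indeed, the closure of the set of translates of \<open>f\<close>
  is compact, and \<open>g\<close> is the restriction of a continuous function on this compact space to the orbit
  of \<open>f\<close>. The Bohr coefficient at \<open>\<xi>\<close> is a continuous function on the same space, whose value at the
  translate of \<open>f\<close> by \<open>h\<close> is \<open>exp (2 \<pi> \<i> \<xi> \<bullet> h)\<close> times its value at \<open>f\<close>. By the
  uniqueness theorem for Bohr coefficients, \<open>bohr_coeff_inject\<close>, the coefficients at the frequencies
  in the spectrum of \<open>f\<close> separate points. The continuous functions on the compact space that become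
  trigonometric polynomials in \<open>h\<close> with frequencies in the group, when they are evaluated at the
  translate by \<open>h\<close>, form an algebra that contains the real and imaginary parts of these coefficients;
  by the Stone--Weierstrass theorem it contains functions arbitrarily close to \<open>g\<close>.

  A uniform limit of trigonometric polynomials with frequencies in \<open>M\<close> is
  almost periodic and has no Bohr coefficients outside \<open>M\<close>; applied to \<open>g = u (t, \<cdot>)\<close> this gives
  both the almost periodicity and the inclusion of the spectra. Continuity in time is the uniform
  continuity of \<open>u\<close> in layers.
\<close>

section \<open>Comparison of viscosity sub- and supersolutions\<close>

text \<open>The test functions of the comparison proof: the first summand keeps the two doubled points close,
  the second stops them from reaching the end of the time interval, and the third stops them from
  escaping to infinity.\<close>

lemma C1_with_gradient_penalty:
  fixes a :: "real \<times> (real^'n)"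
  assumes k: "\<And>t. (k has_real_derivative k' t) (at t)" and k': "continuous_on UNIV k'"
    and e: "e \<noteq> 0"
  shows "C1_with_gradient S (\<lambda>z. (norm (z - a))\<^sup>2 / e + k (fst z) + b * (norm (snd z))\<^sup>2)
    (\<lambda>z. (2 / e) *\<^sub>R (z - a) + (k' (fst z), (2 * b) *\<^sub>R snd z))"
  unfolding C1_with_gradient_def gderiv_def
proof (intro conjI ballI)
  fix z :: "real \<times> (real^'n)"
  have 1: "((\<lambda>z. (norm (z - a))\<^sup>2 / e) has_derivative (\<lambda>h. h \<bullet> ((2 / e) *\<^sub>R (z - a)))) (at z)"
    unfolding power2_norm_eq_inner using e
    by (auto intro!: derivative_eq_intros simp: inner_commute)
  have 2: "((\<lambda>z. b * (norm (snd z))\<^sup>2) has_derivative (\<lambda>h. h \<bullet> (0, (2 * b) *\<^sub>R snd z))) (at z)"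
    unfolding power2_norm_eq_inner
    by (auto intro!: derivative_eq_intros simp: inner_commute inner_Pair_0)
  have "((\<lambda>z. k (fst z)) has_derivative (\<lambda>h. k' (fst z) * fst h)) (at z)"
    using k[of "fst z"] unfolding has_field_derivative_def
    by (rule has_derivative_compose[OF has_derivative_fst[OF has_derivative_ident]])
  then have 3: "((\<lambda>z. k (fst z)) has_derivative (\<lambda>h. h \<bullet> (k' (fst z), 0))) (at z)"
    by (simp add: inner_prod_def mult.commute)
  have "h \<bullet> ((2 / e) *\<^sub>R (z - a) + (k' (fst z), (2 * b) *\<^sub>R snd z)) =
     h \<bullet> ((2 / e) *\<^sub>R (z - a)) + h \<bullet> (k' (fst z), 0) + h \<bullet> (0, (2 * b) *\<^sub>R snd z)" for h
    by (simp add: inner_prod_def inner_add_right distrib_left)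
  then show "((\<lambda>z. (norm (z - a))\<^sup>2 / e + k (fst z) + b * (norm (snd z))\<^sup>2) has_derivative
      (\<lambda>h. h \<bullet> ((2 / e) *\<^sub>R (z - a) + (k' (fst z), (2 * b) *\<^sub>R snd z)))) (at z)"
    using has_derivative_add[OF has_derivative_add[OF 1 3] 2] by simp
next
  show "continuous_on S (\<lambda>z. (2 / e) *\<^sub>R (z - a) + (k' (fst z), (2 * b) *\<^sub>R snd z))"
    by (intro continuous_intros continuous_on_compose2[OF k']) auto
qed

lemma C1_with_gradient_minus:
  "C1_with_gradient S \<phi> G \<Longrightarrow> C1_with_gradient S (\<lambda>z. - \<phi> z) (\<lambda>z. - G z)"
  unfolding C1_with_gradient_def by (intro conjI ballI GDERIV_minus continuous_on_minus) simp_all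

lemma superdifferentialI:
  assumes "C1_with_gradient open_half_space \<phi> G" "open O'" "z \<in> O'"
    and "\<And>w. w \<in> O' \<Longrightarrow> u w - \<phi> w \<le> u z - \<phi> z"
  shows "G z \<in> superdifferential u z"
proof -
  have "\<forall>\<^sub>F w in at z within open_half_space. w \<in> O'"
    using assms(2,3) by (auto simp: eventually_at_topological)
  then have "\<forall>\<^sub>F w in at z within open_half_space. u w - \<phi> w \<le> u z - \<phi> z"
    by eventually_elim (rule assms(4))
  then show ?thesis using assms(1) unfolding superdifferential_def by blast
qed

lemma subdifferentialI:
  assumes "C1_with_gradient open_half_space \<phi> G" "open O'" "z \<in> O'"
    and "\<And>w. w \<in> O' \<Longrightarrow> u w - \<phi> w \<ge> u z - \<phi> z"
  shows "G z \<in> subdifferential u z"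
proof -
  have "\<forall>\<^sub>F w in at z within open_half_space. w \<in> O'"
    using assms(2,3) by (auto simp: eventually_at_topological)
  then have "\<forall>\<^sub>F w in at z within open_half_space. u w - \<phi> w \<ge> u z - \<phi> z"
    by eventually_elim (rule assms(4))
  then show ?thesis using assms(1) unfolding subdifferential_def by blast
qed

text \<open>The layers in \<open>BUC_loc\<close> are half-open; passing to a slightly larger one gives estimates on closed
  layers, which are the ones suited to compactness arguments.\<close>

lemma BUC_loc_bounded:
  assumes "u \<in> BUC_loc" "T \<ge> 0"
  shows "\<exists>C. \<forall>z\<in>{0..T} \<times> UNIV. \<bar>u z\<bar> \<le> C"
proof -
  have "bounded (u ` ({0..<T + 1} \<times> UNIV))" using assms by (simp add: BUC_loc_def)
  then obtain C where "\<forall>z\<in>{0..<T + 1} \<times> UNIV. norm (u z) \<le> C" unfolding bounded_iff by blast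
  then show ?thesis by (intro exI[of _ C]) auto
qed

lemma BUC_loc_modulus:
  assumes "u \<in> BUC_loc" "T \<ge> 0" "e > 0"
  shows "\<exists>r>0. \<forall>z\<in>{0..T} \<times> UNIV. \<forall>w\<in>{0..T} \<times> UNIV. norm (z - w) < r \<longrightarrow> \<bar>u z - u w\<bar> < e"
proof -
  have "uniformly_continuous_on ({0..<T + 1} \<times> UNIV) u" using assms by (simp add: BUC_loc_def)
  then obtain r where r: "r > 0" "\<And>z w. z \<in> {0..<T + 1} \<times> UNIV \<Longrightarrow> w \<in> {0..<T + 1} \<times> UNIV \<Longrightarrow> dist w z < r \<Longrightarrow> dist (u w) (u z) < e"
    unfolding uniformly_continuous_on_def using assms(3) by meson
  have "\<bar>u z - u w\<bar> < e" if "z \<in> {0..T} \<times> UNIV" "w \<in> {0..T} \<times> UNIV" "norm (z - w) < r" for z w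
    using r(2)[of w z] that by (auto simp: dist_norm)
  then show ?thesis using r(1) by blast
qed

lemma BUC_loc_slice:
  assumes u: "u \<in> BUC_loc" and t: "t \<ge> 0"
  shows "(\<lambda>x. u (t, x)) \<in> bcontfun" "uniformly_continuous_on UNIV (\<lambda>x. u (t, x))"
proof -
  show uc: "uniformly_continuous_on UNIV (\<lambda>x. u (t, x))"
    unfolding uniformly_continuous_on_def
  proof (intro allI impI)
    fix e :: real assume "e > 0"
    then obtain r where r: "r > 0" "\<And>z w. z \<in> {0..t} \<times> UNIV \<Longrightarrow> w \<in> {0..t} \<times> UNIV \<Longrightarrow> norm (z - w) < r \<Longrightarrow> \<bar>u z - u w\<bar> < e"
      using BUC_loc_modulus[OF u t] by blast
    have "dist (u (t, y)) (u (t, x)) < e" if "dist y x < r" for x y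
      using r(2)[of "(t, y)" "(t, x)"] that t by (simp add: dist_norm)
    then show "\<exists>d>0. \<forall>x\<in>UNIV. \<forall>y\<in>UNIV. dist y x < d \<longrightarrow> dist (u (t, y)) (u (t, x)) < e" using r(1) by blast
  qed
  obtain C where "\<And>z. z \<in> {0..t} \<times> UNIV \<Longrightarrow> \<bar>u z\<bar> \<le> C" using BUC_loc_bounded[OF u t] by blast
  then have "norm (u (t, x)) \<le> C" for x using t by simp
  then show "(\<lambda>x. u (t, x)) \<in> bcontfun"
    by (intro bcontfun_normI uniformly_continuous_imp_continuous[OF uc])
qed

lemma viscosity_subsolutionD:
  assumes "viscosity_subsolution H u0 u" "(s, p) \<in> superdifferential u z" "fst z > 0"
  shows "s + H p \<le> 0"
proof -
  have "z \<in> open_half_space" using assms(3) by (cases z) (simp add: open_half_space_def)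
  then show ?thesis using assms(1,2) unfolding viscosity_subsolution_def by fast
qed

lemma viscosity_supersolutionD:
  assumes "viscosity_supersolution H u0 u" "(s, p) \<in> subdifferential u z" "fst z > 0"
  shows "s + H p \<ge> 0"
proof -
  have "z \<in> open_half_space" using assms(3) by (cases z) (simp add: open_half_space_def)
  then show ?thesis using assms(1,2) unfolding viscosity_supersolution_def by fast
qed

text \<open>Doubling of variables. If \<open>u - v\<close> were positive at \<open>(t1, x1)\<close>, the function
  \<open>\<Phi>\<close> below, which penalises the distance of the two points, late times and large \<open>x\<close>, would
  attain its maximum at a pair \<open>(z, w)\<close> of nearby points in the interior. The penalty terms supply
  test functions at \<open>z\<close> and \<open>w\<close> whose spatial gradients differ only by the small contribution of
  the penalty at infinity, while their time derivatives differ by the two positive derivatives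
  \<open>\<kappa>'\<close>. Subtracting the two differential inequalities is then contradictory.\<close>

lemma viscosity_comparison:
  fixes H :: "real^'n \<Rightarrow> real"
  assumes H: "continuous_on UNIV H"
    and sub: "viscosity_subsolution H u0 u" and super: "viscosity_supersolution H u0 v"
    and t1: "t1 \<ge> 0"
  shows "u (t1, x1) \<le> v (t1, x1)"
proof (rule ccontr)
  assume "\<not> u (t1, x1) \<le> v (t1, x1)"
  define d where "d = u (t1, x1) - v (t1, x1)"
  then have d: "d > 0" using \<open>\<not> _\<close> by simp
  have u: "u \<in> BUC_loc" and v: "v \<in> BUC_loc"
    using sub super by (auto simp: viscosity_subsolution_def viscosity_supersolution_def)
  have init: "u (0, x) \<le> v (0, x)" for x
    using sub super by (auto simp: viscosity_subsolution_def viscosity_supersolution_def intro: order_trans)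
  have t1: "t1 > 0" using t1 init[of x1] d by (cases "t1 = 0") (auto simp: d_def)
  define T where "T = 2 * t1"
  have T: "T > 0" "T \<ge> 0" using t1 by (auto simp: T_def)
  obtain Cu where Cu: "\<And>z. z \<in> {0..T} \<times> UNIV \<Longrightarrow> \<bar>u z\<bar> \<le> Cu" using BUC_loc_bounded[OF u T(2)] by blast
  obtain Cv where Cv: "\<And>z. z \<in> {0..T} \<times> UNIV \<Longrightarrow> \<bar>v z\<bar> \<le> Cv" using BUC_loc_bounded[OF v T(2)] by blast
  define C where "C = Cu + Cv"
  have C: "u z - v w \<le> C" if "z \<in> {0..T} \<times> UNIV" "w \<in> {0..T} \<times> UNIV" for z w
    using Cu[OF that(1)] Cv[OF that(2)] by (simp add: C_def abs_le_iff)
  have C0: "C > 0" using C[of "(t1, x1)" "(t1, x1)"] t1 d by (simp add: T_def d_def)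
  \<comment> \<open>An exponential is small at \<open>t1\<close>, exceeds \<open>C\<close> at \<open>T\<close> and has a derivative bounded away
    from zero on all of \<open>[0, T]\<close>; the rate \<open>k\<close> is chosen for the second property.\<close>
  define k where "k = 8 * C / (d * t1)"
  have k: "k > 0" using C0 d t1 by (simp add: k_def)
  define \<kappa> where "\<kappa> t = d / 8 * exp (k * (t - t1))" for t
  define \<kappa>' where "\<kappa>' t = k * \<kappa> t" for t
  have \<kappa>_pos: "\<kappa> t > 0" for t using d by (simp add: \<kappa>_def)
  have \<kappa>T: "\<kappa> T > C"
  proof -
    have "C < d / 8 * (1 + k * t1)" using d t1 by (simp add: k_def field_simps)
    also have "\<dots> \<le> \<kappa> T" using d exp_ge_add_one_self[of "k * t1"] by (simp add: \<kappa>_def T_def)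
    finally show ?thesis .
  qed
  have \<kappa>_deriv: "(\<kappa> has_real_derivative \<kappa>' t) (at t)" for t
    unfolding \<kappa>_def[abs_def] \<kappa>'_def by (auto intro!: derivative_eq_intros)
  have \<kappa>_cont: "continuous_on S \<kappa>" for S
    unfolding \<kappa>_def[abs_def] by (intro continuous_intros)
  have \<kappa>'_cont: "continuous_on S \<kappa>'" for S
    unfolding \<kappa>'_def[abs_def] by (intro continuous_intros \<kappa>_cont)
  define c where "c = \<kappa>' 0"
  have c: "c > 0" by (simp add: c_def \<kappa>'_def k \<kappa>_pos)
  have c_le: "c \<le> \<kappa>' t" if "t \<ge> 0" for t
    using that d k by (simp add: c_def \<kappa>'_def \<kappa>_def right_diff_distrib)
  obtain ru where ru: "ru > 0" "\<And>z w. z \<in> {0..T} \<times> UNIV \<Longrightarrow> w \<in> {0..T} \<times> UNIV \<Longrightarrow> norm (z - w) < ru \<Longrightarrow> \<bar>u z - u w\<bar> < d / 4"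
    using BUC_loc_modulus[OF u T(2), of "d / 4"] d by auto
  obtain rv where rv: "rv > 0" "\<And>z w. z \<in> {0..T} \<times> UNIV \<Longrightarrow> w \<in> {0..T} \<times> UNIV \<Longrightarrow> norm (z - w) < rv \<Longrightarrow> \<bar>v z - v w\<bar> < d / 4"
    using BUC_loc_modulus[OF v T(2), of "d / 4"] d by auto
  define r where "r = min ru rv"
  have r: "r > 0" using ru(1) rv(1) by (simp add: r_def)
  \<comment> \<open>With this \<open>\<epsilon>\<close> two points at distance \<open>r\<close> or more cost at least \<open>C\<close>, so the maximising
    points are closer than \<open>r\<close>, and the common part of the two gradients has norm at most \<open>B\<close>.\<close>
  define \<epsilon> where "\<epsilon> = r\<^sup>2 / C"
  have \<epsilon>: "\<epsilon> > 0" using r C0 by (simp add: \<epsilon>_def)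
  define B where "B = 2 / \<epsilon> * r"
  have "uniformly_continuous_on (cball 0 (B + 1)) H"
    by (intro compact_uniformly_continuous continuous_on_subset[OF H]) auto
  then obtain \<rho> where \<rho>0: "\<rho> > 0" and
      \<rho>1: "\<And>p q. p \<in> cball 0 (B + 1) \<Longrightarrow> q \<in> cball 0 (B + 1) \<Longrightarrow> dist q p < \<rho> \<Longrightarrow> dist (H q) (H p) < 2 * c"
    unfolding uniformly_continuous_on_def using c by (metis mult_pos_pos zero_less_numeral)
  have \<rho>: "\<bar>H p - H q\<bar> < 2 * c" if "norm p \<le> B + 1" "norm q \<le> B + 1" "norm (p - q) < \<rho>" for p q
    using \<rho>1[of q p] that by (simp add: dist_norm)
  define \<eta> where "\<eta> = min 1 (\<rho> / 2)"
  have \<eta>: "\<eta> > 0" "\<eta> \<le> 1" "\<eta> \<le> \<rho> / 2" using \<rho>0 by (auto simp: \<eta>_def)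
  \<comment> \<open>The penalty at infinity is chosen after \<open>\<epsilon>\<close> and \<open>\<rho>\<close>: the first bound keeps \<open>\<Phi>\<close>
    large at \<open>(t1, x1)\<close>, the second makes its gradient at the maximum smaller than \<open>\<eta>\<close>.\<close>
  define \<beta> where "\<beta> = min (d / (8 * ((norm x1)\<^sup>2 + 1))) (\<eta>\<^sup>2 / (4 * C))"
  have nx: "(norm x1)\<^sup>2 + 1 > 0" by (simp add: add_nonneg_pos)
  have \<beta>: "\<beta> > 0" using d nx \<eta>(1) C0 by (simp add: \<beta>_def)
  have \<beta>x1: "2 * (\<beta> * (norm x1)\<^sup>2) \<le> d / 4"
  proof -
    have "\<beta> * (norm x1)\<^sup>2 \<le> \<beta> * ((norm x1)\<^sup>2 + 1)" using \<beta> by (intro mult_left_mono) auto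
    also have "\<dots> \<le> d / (8 * ((norm x1)\<^sup>2 + 1)) * ((norm x1)\<^sup>2 + 1)"
      using nx by (intro mult_right_mono) (auto simp: \<beta>_def)
    also have "\<dots> = d / 8"
    proof -
      have "d / (8 * X) * X = d / 8" if "X > 0" for X :: real using that by simp
      then show ?thesis using nx .
    qed
    finally show ?thesis by simp
  qed
  have grad_small: "norm ((2 * \<beta>) *\<^sub>R x) < \<eta>" if "\<beta> * (norm x)\<^sup>2 < C" for x :: "real^'n"
  proof (rule power2_less_imp_less)
    have "(norm ((2 * \<beta>) *\<^sub>R x))\<^sup>2 = 4 * \<beta> * (\<beta> * (norm x)\<^sup>2)" by (simp add: power2_eq_square)
    also have "\<dots> < 4 * \<beta> * C" using that \<beta> by simp
    also have "\<dots> \<le> 4 * (\<eta>\<^sup>2 / (4 * C)) * C" using C0 by (intro mult_right_mono) (auto simp: \<beta>_def)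
    also have "\<dots> = \<eta>\<^sup>2" using C0 by simp
    finally show "(norm ((2 * \<beta>) *\<^sub>R x))\<^sup>2 < \<eta>\<^sup>2" .
  qed (use \<eta> in simp)
  define R where "R = norm x1 + 1 + C / \<beta>"
  have R1: "R \<ge> 1" "R > C / \<beta>" "norm x1 < R" using C0 \<beta> by (auto simp: R_def add_pos_nonneg add_nonneg_pos)
  have in_R: "norm x < R" if "\<beta> * (norm x)\<^sup>2 < C" for x :: "real^'n"
  proof (rule ccontr)
    assume "\<not> norm x < R"
    then have "R * 1 \<le> norm x * norm x" using R1(1) by (intro mult_mono) auto
    then have "C / \<beta> < (norm x)\<^sup>2" using R1(2) by (simp add: power2_eq_square)
    then show False using that \<beta> by (simp add: field_simps)
  qed
  define D :: "(real \<times> (real^'n)) set" where "D = {0..T} \<times> cball 0 R"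
  define \<Phi> where "\<Phi> = (\<lambda>(z :: real \<times> (real^'n), w :: real \<times> (real^'n)). u z - v w - (norm (z - w))\<^sup>2 / \<epsilon> - \<kappa> (fst z) - \<kappa> (fst w)
     - \<beta> * (norm (snd z))\<^sup>2 - \<beta> * (norm (snd w))\<^sup>2)"
  have D_layer: "z \<in> {0..T} \<times> UNIV" if "z \<in> D" for z using that by (auto simp: D_def)
  have contu: "continuous_on D u" and contv: "continuous_on D v"
    using u v by (auto simp: BUC_loc_def D_def closed_half_space_def elim: continuous_on_subset)
  have "compact (D \<times> D)" unfolding D_def by (intro compact_Times) auto
  moreover have pD: "((t1, x1), (t1, x1)) \<in> D \<times> D" using t1 R1(3) by (auto simp: D_def T_def)
  moreover have "continuous_on (D \<times> D) \<Phi>"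
    unfolding \<Phi>_def case_prod_unfold using \<epsilon>
    by (intro continuous_intros continuous_on_compose2[OF contu] continuous_on_compose2[OF contv]
        continuous_on_compose2[OF \<kappa>_cont[of UNIV]]) auto
  ultimately obtain m where m: "m \<in> D \<times> D" "\<And>y. y \<in> D \<times> D \<Longrightarrow> \<Phi> y \<le> \<Phi> m"
    using continuous_attains_sup[of "D \<times> D" \<Phi>] by blast
  obtain z w where zw: "m = (z, w)" by (cases m)
  have zD: "z \<in> D" and wD: "w \<in> D" using m(1) by (auto simp: zw)
  have "d / 2 \<le> \<Phi> ((t1, x1), (t1, x1))"
  proof -
    have "\<Phi> ((t1, x1), (t1, x1)) = d - d / 8 - d / 8 - 2 * (\<beta> * (norm x1)\<^sup>2)"
      by (simp add: \<Phi>_def \<kappa>_def) (simp add: d_def)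
    then show ?thesis using \<beta>x1 by linarith
  qed
  also have "\<dots> \<le> \<Phi> (z, w)" using m(2)[OF pD] by (simp add: zw)
  finally have \<Phi>_ge: "d / 2 \<le> \<Phi> (z, w)" .
  have nonneg: "(norm (z - w))\<^sup>2 / \<epsilon> \<ge> 0" "\<kappa> (fst z) > 0" "\<kappa> (fst w) > 0" "\<beta> * (norm (snd z))\<^sup>2 \<ge> 0" "\<beta> * (norm (snd w))\<^sup>2 \<ge> 0"
    using \<epsilon> \<kappa>_pos \<beta> by auto
  have \<Phi>_eq: "\<Phi> (z, w) = u z - v w - (norm (z - w))\<^sup>2 / \<epsilon> - \<kappa> (fst z) - \<kappa> (fst w)
     - \<beta> * (norm (snd z))\<^sup>2 - \<beta> * (norm (snd w))\<^sup>2" by (simp add: \<Phi>_def)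
  have uv: "d / 2 \<le> u z - v w" using \<Phi>_ge \<Phi>_eq nonneg by linarith
  have uvC: "u z - v w \<le> C" by (rule C[OF D_layer[OF zD] D_layer[OF wD]])
  have bounds: "(norm (z - w))\<^sup>2 / \<epsilon> < C" "\<kappa> (fst z) < C" "\<kappa> (fst w) < C" "\<beta> * (norm (snd z))\<^sup>2 < C" "\<beta> * (norm (snd w))\<^sup>2 < C"
    using \<Phi>_ge \<Phi>_eq nonneg uvC d by linarith+
  have dist_zw: "norm (z - w) < r"
  proof (rule power2_less_imp_less)
    show "(norm (z - w))\<^sup>2 < r\<^sup>2" using bounds(1) \<epsilon> C0 r by (simp add: \<epsilon>_def field_simps)
  qed (use r in simp)
  have lt_T: "t < T" if "t \<le> T" "\<kappa> t < C" for t
    using that \<kappa>T by (cases "t = T") auto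
  \<comment> \<open>At time zero the ordering of the initial data and the moduli of continuity contradict \<open>uv\<close>.\<close>
  have z_pos: "fst z > 0"
  proof (rule ccontr)
    assume "\<not> fst z > 0"
    then have z0: "z = (0, snd z)" using zD by (auto simp: D_def prod_eq_iff)
    have "\<bar>v z - v w\<bar> < d / 4" using dist_zw by (intro rv D_layer zD wD) (simp add: r_def)
    moreover have "u z \<le> v z" using init[of "snd z"] z0 by simp
    ultimately show False using uv d by linarith
  qed
  have w_pos: "fst w > 0"
  proof (rule ccontr)
    assume "\<not> fst w > 0"
    then have w0: "w = (0, snd w)" using wD by (auto simp: D_def prod_eq_iff)
    have "\<bar>u z - u w\<bar> < d / 4" using dist_zw by (intro ru D_layer zD wD) (simp add: r_def)
    moreover have "u w \<le> v w" using init[of "snd w"] w0 by simp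
    ultimately show False using uv d by linarith
  qed
  define O' :: "(real \<times> (real^'n)) set" where "O' = {0<..<T} \<times> ball 0 R"
  have O': "open O'" unfolding O'_def by (intro open_Times) auto
  have O'_sub: "y \<in> D" if "y \<in> O'" for y using that by (auto simp: O'_def D_def)
  have zO: "z \<in> O'"
    using zD z_pos lt_T[OF _ bounds(2)] in_R[OF bounds(4)] by (cases z) (auto simp: O'_def D_def)
  have wO: "w \<in> O'"
    using wD w_pos lt_T[OF _ bounds(3)] in_R[OF bounds(5)] by (cases w) (auto simp: O'_def D_def)
  define pen where "pen a y = (norm (y - a))\<^sup>2 / \<epsilon> + \<kappa> (fst y) + \<beta> * (norm (snd y))\<^sup>2" for a y :: "real \<times> (real^'n)"
  define Gp where "Gp a y = (2 / \<epsilon>) *\<^sub>R (y - a) + (\<kappa>' (fst y), (2 * \<beta>) *\<^sub>R snd y)" for a y :: "real \<times> (real^'n)"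
  have C1: "C1_with_gradient open_half_space (pen a) (Gp a)" for a
    unfolding pen_def[abs_def] Gp_def[abs_def] using \<epsilon>
    by (intro C1_with_gradient_penalty \<kappa>_deriv \<kappa>'_cont) simp
  have "Gp w z \<in> superdifferential u z"
  proof (rule superdifferentialI[OF C1 O' zO])
    fix y assume "y \<in> O'"
    then have "\<Phi> (y, w) \<le> \<Phi> (z, w)" using m(2)[of "(y, w)"] O'_sub wD by (simp add: zw)
    then show "u y - pen w y \<le> u z - pen w z" by (simp add: \<Phi>_def pen_def)
  qed
  moreover have "Gp w z = (2 / \<epsilon> * (fst z - fst w) + \<kappa>' (fst z), (2 / \<epsilon>) *\<^sub>R (snd z - snd w) + (2 * \<beta>) *\<^sub>R snd z)"
    by (simp add: Gp_def prod_eq_iff)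
  ultimately have sub_ineq: "2 / \<epsilon> * (fst z - fst w) + \<kappa>' (fst z) + H ((2 / \<epsilon>) *\<^sub>R (snd z - snd w) + (2 * \<beta>) *\<^sub>R snd z) \<le> 0"
    by (intro viscosity_subsolutionD[OF sub _ z_pos]) simp
  have "- Gp z w \<in> subdifferential v w"
  proof (rule subdifferentialI[OF C1_with_gradient_minus[OF C1] O' wO])
    fix y assume "y \<in> O'"
    then have "\<Phi> (z, y) \<le> \<Phi> (z, w)" using m(2)[of "(z, y)"] O'_sub zD by (simp add: zw)
    then show "v y - - pen z y \<ge> v w - - pen z w" by (simp add: \<Phi>_def pen_def norm_minus_commute)
  qed
  moreover have "- Gp z w = (2 / \<epsilon> * (fst z - fst w) - \<kappa>' (fst w), (2 / \<epsilon>) *\<^sub>R (snd z - snd w) - (2 * \<beta>) *\<^sub>R snd w)"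
    by (simp add: Gp_def prod_eq_iff scaleR_diff_right right_diff_distrib diff_divide_distrib)
  ultimately have super_ineq: "2 / \<epsilon> * (fst z - fst w) - \<kappa>' (fst w) + H ((2 / \<epsilon>) *\<^sub>R (snd z - snd w) - (2 * \<beta>) *\<^sub>R snd w) \<ge> 0"
    by (intro viscosity_supersolutionD[OF super _ w_pos]) simp
  let ?q = "(2 / \<epsilon>) *\<^sub>R (snd z - snd w)"
  have "norm (snd z - snd w) \<le> norm (z - w)" 
    by (metis norm_snd_le prod.collapse snd_diff)
  then have q: "norm ?q \<le> B"
    unfolding B_def norm_scaleR using \<epsilon> dist_zw by (intro mult_mono) auto
  have small: "norm ((2 * \<beta>) *\<^sub>R snd z) < \<eta>" "norm ((2 * \<beta>) *\<^sub>R snd w) < \<eta>"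
    using grad_small[OF bounds(4)] grad_small[OF bounds(5)] .
  have "\<bar>H (?q + (2 * \<beta>) *\<^sub>R snd z) - H (?q - (2 * \<beta>) *\<^sub>R snd w)\<bar> < 2 * c"
  proof (rule \<rho>)
    show "norm (?q + (2 * \<beta>) *\<^sub>R snd z) \<le> B + 1"
      using norm_triangle_ineq[of ?q "(2 * \<beta>) *\<^sub>R snd z"] q small(1) \<eta>(2) by linarith
    show "norm (?q - (2 * \<beta>) *\<^sub>R snd w) \<le> B + 1"
      using norm_triangle_ineq4[of ?q "(2 * \<beta>) *\<^sub>R snd w"] q small(2) \<eta>(2) by linarith
    have "norm ((?q + (2 * \<beta>) *\<^sub>R snd z) - (?q - (2 * \<beta>) *\<^sub>R snd w)) = norm ((2 * \<beta>) *\<^sub>R snd z + (2 * \<beta>) *\<^sub>R snd w)" by simp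
    then show "norm ((?q + (2 * \<beta>) *\<^sub>R snd z) - (?q - (2 * \<beta>) *\<^sub>R snd w)) < \<rho>"
      using norm_triangle_ineq[of "(2 * \<beta>) *\<^sub>R snd z" "(2 * \<beta>) *\<^sub>R snd w"] small \<eta>(3) by linarith
  qed
  moreover have "c \<le> \<kappa>' (fst z)" "c \<le> \<kappa>' (fst w)" using z_pos w_pos by (auto intro: c_le)
  ultimately show False using sub_ineq super_ineq by linarith
qed

lemma BUC_loc_shift:
  fixes h :: "real^'n"
  assumes "u \<in> BUC_loc" shows "(\<lambda>z. u (z + (0, h)) + c) \<in> BUC_loc"
proof -
  have img: "(\<lambda>z. z + (0, h)) ` (I \<times> UNIV) \<subseteq> I \<times> UNIV" for I :: "real set" by auto
  have 1: "continuous_on closed_half_space (\<lambda>z. u (z + (0, h)) + c)"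
  proof -
    have "continuous_on closed_half_space u" using assms by (simp add: BUC_loc_def)
    moreover have "continuous_on closed_half_space (\<lambda>z::real \<times> (real^'n). z + (0, h))" by (intro continuous_intros)
    ultimately have "continuous_on closed_half_space (\<lambda>z. u (z + (0, h)))"
      by (rule continuous_on_compose2) (simp only: closed_half_space_def img)
    then show ?thesis by (intro continuous_on_add continuous_on_const)
  qed
  have 2: "bounded ((\<lambda>z. u (z + (0, h)) + c) ` ({0..<T} \<times> UNIV))" if "T > 0" for T
  proof -
    have "bounded (u ` ({0..<T} \<times> UNIV))" using assms that by (simp add: BUC_loc_def)
    then obtain C where C: "\<And>z. z \<in> {0..<T} \<times> UNIV \<Longrightarrow> norm (u z) \<le> C" unfolding bounded_iff by blast
    have "norm (u (z + (0, h)) + c) \<le> C + \<bar>c\<bar>" if "z \<in> {0..<T} \<times> UNIV" for z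
    proof -
      have "z + (0, h) \<in> {0..<T} \<times> UNIV" using that by auto
      from C[OF this] show ?thesis by simp
    qed
    then show ?thesis unfolding bounded_iff by blast
  qed
  have 3: "uniformly_continuous_on ({0..<T} \<times> UNIV) (\<lambda>z. u (z + (0, h)) + c)" if "T > 0" for T
  proof -
    have uc: "uniformly_continuous_on ({0..<T} \<times> UNIV) u" using assms that by (simp add: BUC_loc_def)
    have "uniformly_continuous_on ({0..<T} \<times> UNIV) (\<lambda>z. u (z + (0, h)))"
      unfolding uniformly_continuous_on_def
    proof (intro allI impI)
      fix e :: real assume "e > 0"
      then obtain r where r: "r > 0" "\<And>x y. x \<in> {0..<T} \<times> UNIV \<Longrightarrow> y \<in> {0..<T} \<times> UNIV \<Longrightarrow> dist y x < r \<Longrightarrow> dist (u y) (u x) < e"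
        using uc unfolding uniformly_continuous_on_def by meson
      have "dist (u (y + (0, h))) (u (x + (0, h))) < e"
        if "x \<in> {0..<T} \<times> UNIV" "y \<in> {0..<T} \<times> UNIV" "dist y x < r" for x y
      proof (rule r(2))
        show "x + (0, h) \<in> {0..<T} \<times> UNIV" "y + (0, h) \<in> {0..<T} \<times> UNIV"
          by (rule subsetD[OF img imageI], rule that)+
      qed (use that(3) in \<open>simp add: dist_norm\<close>)
      then show "\<exists>d>0. \<forall>x\<in>{0..<T} \<times> UNIV. \<forall>y\<in>{0..<T} \<times> UNIV. dist y x < d \<longrightarrow>
          dist (u (y + (0, h))) (u (x + (0, h))) < e" using r(1) by blast
    qed
    then show ?thesis by (intro uniformly_continuous_on_add uniformly_continuous_on_const)
  qed
  show ?thesis using 1 2 3 by (simp add: BUC_loc_def)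
qed

text \<open>Test functions are translated along with \<open>u\<close>; this works because the open half-space is
  invariant under translations in \<open>x\<close>.\<close>

lemma subdifferential_shift:
  fixes h :: "real^'n"
  assumes "P \<in> subdifferential (\<lambda>z. u (z + (0, h)) + c) z"
  shows "P \<in> subdifferential u (z + (0, h))"
proof -
  obtain \<phi> G where P: "P = G z" and C1: "C1_with_gradient open_half_space \<phi> G"
    and ev: "\<forall>\<^sub>F w in at z within open_half_space. u (w + (0, h)) + c - \<phi> w \<ge> u (z + (0, h)) + c - \<phi> z"
    using assms unfolding subdifferential_def by blast
  have inv: "w + (0, k) \<in> open_half_space \<longleftrightarrow> w \<in> open_half_space" for w :: "real \<times> (real^'n)" and k
    by (cases w) (simp add: open_half_space_def)
  have "C1_with_gradient open_half_space (\<lambda>w. \<phi> (w - (0, h))) (\<lambda>w. G (w - (0, h)))"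
    unfolding C1_with_gradient_def
  proof (intro conjI ballI)
    fix w :: "real \<times> (real^'n)" assume "w \<in> open_half_space"
    then have "w - (0, h) \<in> open_half_space" using inv[of "w - (0, h)" h] by simp
    then have "(\<phi> has_derivative (\<lambda>y. y \<bullet> G (w - (0, h)))) (at (w - (0, h)))"
      using C1 by (simp add: C1_with_gradient_def gderiv_def)
    moreover have "((\<lambda>w. w - (0, h)) has_derivative (\<lambda>y. y)) (at w)"
      by (auto intro!: derivative_eq_intros)
    ultimately show "GDERIV (\<lambda>w. \<phi> (w - (0, h))) w :> G (w - (0, h))"
      unfolding gderiv_def using has_derivative_compose by blast
  next
    have "continuous_on open_half_space G" using C1 by (simp add: C1_with_gradient_def)
    then show "continuous_on open_half_space (\<lambda>w. G (w - (0, h)))"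
      by (rule continuous_on_compose2) (use inv[of _ "- h"] in \<open>auto intro!: continuous_intros\<close>)
  qed
  moreover have "\<forall>\<^sub>F w in at (z + (0, h)) within open_half_space. u w - \<phi> (w - (0, h)) \<ge> u (z + (0, h)) - \<phi> z"
  proof -
    obtain r where r: "r > 0" "\<And>w. w \<in> open_half_space \<Longrightarrow> w \<noteq> z \<Longrightarrow> dist w z < r \<Longrightarrow>
        u (w + (0, h)) + c - \<phi> w \<ge> u (z + (0, h)) + c - \<phi> z"
      using ev unfolding eventually_at by blast
    show ?thesis unfolding eventually_at
    proof (intro exI[of _ r] conjI ballI impI r(1))
      fix w :: "real \<times> (real^'n)" assume w: "w \<in> open_half_space" "w \<noteq> z + (0, h) \<and> dist w (z + (0, h)) < r"
      have "w - (0, h) \<in> open_half_space" "w - (0, h) \<noteq> z" "dist (w - (0, h)) z < r"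
        using w inv[of "w - (0, h)" h] by (auto simp: dist_norm algebra_simps)
      from r(2)[OF this] show "u w - \<phi> (w - (0, h)) \<ge> u (z + (0, h)) - \<phi> z" by simp
    qed
  qed
  ultimately show ?thesis unfolding subdifferential_def mem_Collect_eq
    by (intro exI[of _ "\<lambda>w. \<phi> (w - (0, h))"] exI[of _ "\<lambda>w. G (w - (0, h))"] conjI) (simp_all add: P)
qed

lemma viscosity_supersolution_shift:
  fixes h :: "real^'n"
  assumes super: "viscosity_supersolution H u0 u" and init: "\<And>x. v0 x \<le> u0 (x + h) + c"
  shows "viscosity_supersolution H v0 (\<lambda>z. u (z + (0, h)) + c)"
  unfolding viscosity_supersolution_def
proof (intro conjI allI ballI)
  show "(\<lambda>z. u (z + (0, h)) + c) \<in> BUC_loc"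
    using super by (intro BUC_loc_shift) (simp add: viscosity_supersolution_def)
  have "u0 x \<le> u (0, x)" for x using super by (simp add: viscosity_supersolution_def)
  then show "v0 x \<le> u ((0, x) + (0, h)) + c" for x 
    using init[of x] order_trans[of "v0 x" "u0 (x + h) + c" "u (0, x + h) + c"] by simp
next
  fix z P assume "z \<in> open_half_space" and P: "P \<in> subdifferential (\<lambda>z. u (z + (0, h)) + c) z"
  then have "fst (z + (0, h)) > 0" by (cases z) (simp add: open_half_space_def)
  then show "case P of (s, p) \<Rightarrow> 0 \<le> s + H p"
    using viscosity_supersolutionD[OF super] subdifferential_shift[OF P] by (cases P) auto
qed

text \<open>The translate of \<open>u\<close> by \<open>h\<close>, raised by \<open>C\<close>, is a supersolution of the same Cauchy problem, so
  comparison gives one inequality; the translate by \<open>- h\<close> gives the other.\<close>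

lemma viscosity_solution_translation_stable:
  fixes H :: "real^'n \<Rightarrow> real"
  assumes H: "continuous_on UNIV H" and sol: "viscosity_solution H u0 u" and t: "t \<ge> 0"
    and C: "\<And>x. \<bar>u0 (x + h) - u0 x\<bar> \<le> C"
  shows "\<bar>u (t, x + h) - u (t, x)\<bar> \<le> C"
proof -
  have sub: "viscosity_subsolution H u0 u" and super: "viscosity_supersolution H u0 u"
    using sol by (auto simp: viscosity_solution_def)
  have "u0 x \<le> u0 (x + h) + C" for x using C[of x] by (simp add: abs_le_iff)
  then have 1: "viscosity_supersolution H u0 (\<lambda>z. u (z + (0, h)) + C)"
    by (rule viscosity_supersolution_shift[OF super])
  have "u0 x \<le> u0 (x + - h) + C" for x using C[of "x - h"] by (simp add: abs_le_iff)
  then have 2: "viscosity_supersolution H u0 (\<lambda>z. u (z + (0, - h)) + C)"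
    by (rule viscosity_supersolution_shift[OF super])
  have "u (t, x) \<le> u ((t, x) + (0, h)) + C" by (rule viscosity_comparison[OF H sub 1 t])
  moreover have "u (t, x + h) \<le> u ((t, x + h) + (0, - h)) + C" by (rule viscosity_comparison[OF H sub 2 t])
  ultimately have "u (t, x) \<le> u (t, x + h) + C" "u (t, x + h) \<le> u (t, x) + C" by simp_all
  then show ?thesis by linarith
qed

section \<open>Mean values over growing cubes\<close>

definition cube_mean :: "real \<Rightarrow> (real^'n \<Rightarrow> complex) \<Rightarrow> complex"
  where "cube_mean R F = integral (centered_cube R) F /\<^sub>R R ^ CARD('n)"

text \<open>A relational form of the limit that defines the Bohr coefficients: it asserts that the limit exists,
  which \<open>Lim\<close> cannot express.\<close>

definition has_mean :: "(real^'n \<Rightarrow> complex) \<Rightarrow> complex \<Rightarrow> bool"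
  where "has_mean F m \<longleftrightarrow> ((\<lambda>R. cube_mean R F) \<longlongrightarrow> m) at_top"

lemma centered_cube_eq_cbox: "centered_cube R = cbox (\<chi> i. - (R / 2)) (\<chi> i. R / 2)"
proof -
  have "\<bar>y\<bar> \<le> R / 2 \<longleftrightarrow> - (R / 2) \<le> y \<and> y \<le> R / 2" for y :: real
    by (simp only: abs_le_iff) linarith
  then show ?thesis
    by (auto simp only: centered_cube_def mem_box_cart set_eq_iff mem_Collect_eq vec_lambda_beta)
qed

lemma content_centered_cube:
  assumes "R \<ge> 0" shows "measure lborel (centered_cube R :: (real^'n) set) = R ^ CARD('n)"
proof -
  have "(0 :: real^'n) \<in> centered_cube R" using assms by (simp add: centered_cube_def)
  then show ?thesis unfolding centered_cube_eq_cbox by (subst content_cbox_cart) auto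
qed

lemma integrable_centered_cube:
  "continuous_on UNIV F \<Longrightarrow> (F :: real^'n \<Rightarrow> complex) integrable_on centered_cube R"
  unfolding centered_cube_eq_cbox by (rule integrable_continuous, rule continuous_on_subset) auto

lemma norm_integral_diff_nested_cboxes:
  fixes F :: "real^'n \<Rightarrow> complex"
  assumes F: "continuous_on UNIV F" "\<And>x. norm (F x) \<le> c" and sub: "cbox a b \<subseteq> cbox p q"
  shows "norm (integral (cbox p q) F - integral (cbox a b) F) \<le> c * (measure lborel (cbox p q) - measure lborel (cbox a b))"
proof -
  have i: "F integrable_on cbox p q" "F integrable_on cbox a b"
    by (rule integrable_continuous, rule continuous_on_subset[OF F(1)], simp)+
  have neg: "negligible (cbox a b - cbox p q)" using sub by (simp add: Diff_eq_empty_iff[THEN iffD2])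
  have ic: "(\<lambda>_. c) integrable_on cbox p q" "(\<lambda>_. c) integrable_on cbox a b" by auto
  have "norm (integral (cbox p q - cbox a b) F) \<le> integral (cbox p q - cbox a b) (\<lambda>_. c)"
    using F(2) by (intro integral_norm_bound_integral)
       (auto intro!: integrable_setdiff[OF integrable_integral integrable_integral] i ic neg)
  then show ?thesis
    by (simp only: integral_setdiff[OF i neg] integral_setdiff[OF ic neg])
       (simp add: algebra_simps)
qed

lemma norm_cube_mean_le:
  fixes F :: "real^'n \<Rightarrow> complex"
  assumes "continuous_on UNIV F" "\<And>x. norm (F x) \<le> c" "R > 0"
  shows "norm (cube_mean R F) \<le> c"
proof -
  have "norm (integral (centered_cube R) F) \<le> integral (centered_cube R :: (real^'n) set) (\<lambda>_. c)"
    using assms(2) by (intro integral_norm_bound_integral integrable_centered_cube assms(1))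
      (auto simp: centered_cube_eq_cbox)
  also have "\<dots> = c * R ^ CARD('n)"
    using content_centered_cube[where 'n='n, of R] assms(3) by (simp add: centered_cube_eq_cbox)
  finally show ?thesis using assms(3) by (simp add: cube_mean_def field_simps)
qed

lemma cube_mean_add:
  "continuous_on UNIV F \<Longrightarrow> continuous_on UNIV G \<Longrightarrow>
    cube_mean R (\<lambda>x. F x + G x) = cube_mean R F + cube_mean R G"
  by (simp add: cube_mean_def integral_add integrable_centered_cube scaleR_right_distrib)

lemma cube_mean_diff:
  "continuous_on UNIV F \<Longrightarrow> continuous_on UNIV G \<Longrightarrow>
    cube_mean R (\<lambda>x. F x - G x) = cube_mean R F - cube_mean R G"
  by (simp add: cube_mean_def integral_diff integrable_centered_cube scaleR_right_diff_distrib)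

lemma cube_mean_cmult: "cube_mean R (\<lambda>x. c * F x) = c * cube_mean R F"
  by (simp add: cube_mean_def)

lemma cube_mean_const: "R > 0 \<Longrightarrow> cube_mean R (\<lambda>x::real^'n. c) = c"
  using content_centered_cube[where 'n='n, of R]
  by (simp add: cube_mean_def centered_cube_eq_cbox)

lemma has_mean_add:
  "continuous_on UNIV F \<Longrightarrow> continuous_on UNIV G \<Longrightarrow> has_mean F a \<Longrightarrow> has_mean G b \<Longrightarrow>
    has_mean (\<lambda>x. F x + G x) (a + b)"
  unfolding has_mean_def by (simp add: cube_mean_add tendsto_add)

lemma has_mean_diff:
  "continuous_on UNIV F \<Longrightarrow> continuous_on UNIV G \<Longrightarrow> has_mean F a \<Longrightarrow> has_mean G b \<Longrightarrow>
    has_mean (\<lambda>x. F x - G x) (a - b)"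
  unfolding has_mean_def by (simp add: cube_mean_diff tendsto_diff)

lemma has_mean_cmult: "has_mean F a \<Longrightarrow> has_mean (\<lambda>x. c * F x) (c * a)"
  unfolding has_mean_def by (simp add: cube_mean_cmult tendsto_mult)

lemma has_mean_const: "has_mean (\<lambda>_. c) c"
  unfolding has_mean_def
  by (intro tendsto_eventually eventually_mono[OF eventually_gt_at_top[of 0]] cube_mean_const)

lemma has_mean_norm_le:
  assumes "continuous_on UNIV F" "\<And>x. norm (F x) \<le> c" "has_mean F m"
  shows "norm m \<le> c"
proof (rule Lim_norm_ubound)
  show "((\<lambda>R. cube_mean R F) \<longlongrightarrow> m) at_top" using assms(3) by (simp add: has_mean_def)
  show "\<forall>\<^sub>F R in at_top. norm (cube_mean R F) \<le> c"
    by (rule eventually_mono[OF eventually_gt_at_top[of 0]]) (intro norm_cube_mean_le assms)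
qed simp

text \<open>Both the cube of side \<open>R\<close> and its translate by \<open>h\<close> contain the cube of side
  \<open>R - 2 * norm h\<close>, and the volume that they have outside of it is negligible compared with
  \<open>R ^ n\<close>.\<close>

lemma cube_mean_translate_tendsto:
  fixes F :: "real^'n \<Rightarrow> complex"
  assumes F: "continuous_on UNIV F" "\<And>x. norm (F x) \<le> c"
  shows "((\<lambda>R. cube_mean R (\<lambda>x. F (x + h)) - cube_mean R F) \<longlongrightarrow> 0) at_top"
proof -
  define n where "n = CARD('n)"
  define a where "a = norm h"
  have c0: "c \<ge> 0" using F(2)[of 0] norm_ge_zero order_trans by blast
  have bd: "norm (cube_mean R (\<lambda>x. F (x + h)) - cube_mean R F) \<le> 2 * c * (1 - (1 - 2 * a / R) ^ n)"
    if R: "R > 2 * a" for R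
  proof -
    have a0: "a \<ge> 0" by (simp add: a_def)
    have R0: "R > 0" "R - 2 * a > 0" using R a0 by auto
    define p q :: "real^'n" where "p = (\<chi> i. - (R / 2))" and "q = (\<chi> i. R / 2)"
    have pq: "centered_cube R = cbox p q" by (simp add: centered_cube_eq_cbox p_def q_def)
    define r s :: "real^'n" where "r = (\<chi> i. - ((R - 2 * a) / 2))" and "s = (\<chi> i. (R - 2 * a) / 2)"
    have rs: "centered_cube (R - 2 * a) = cbox r s" by (simp add: centered_cube_eq_cbox r_def s_def)
    have hi: "\<bar>h $ i\<bar> \<le> a" for i by (simp add: a_def component_le_norm_cart)
    have s1: "cbox r s \<subseteq> cbox p q"
    proof
      fix x assume "x \<in> cbox r s"
      then have x: "- ((R - 2 * a) / 2) \<le> x $ i \<and> x $ i \<le> (R - 2 * a) / 2" for i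
        by (auto simp: mem_box_cart r_def s_def)
      have "- (R / 2) \<le> x $ i \<and> x $ i \<le> R / 2" for i
        using x[of i] a0 by (auto simp: field_simps)
      then show "x \<in> cbox p q" by (simp add: mem_box_cart p_def q_def)
    qed
    have s2: "cbox r s \<subseteq> cbox (p + h) (q + h)"
    proof
      fix x assume "x \<in> cbox r s"
      then have x: "- ((R - 2 * a) / 2) \<le> x $ i \<and> x $ i \<le> (R - 2 * a) / 2" for i
        by (auto simp: mem_box_cart r_def s_def)
      have "- (R / 2) + h $ i \<le> x $ i \<and> x $ i \<le> R / 2 + h $ i" for i
        using x[of i] hi[of i] by (auto simp: abs_le_iff field_simps)
      then show "x \<in> cbox (p + h) (q + h)" by (simp add: mem_box_cart p_def q_def)
    qed
    have cont: "measure lborel (cbox p q) = R ^ n" "measure lborel (cbox r s) = (R - 2 * a) ^ n"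
      using content_centered_cube[where 'n='n, of R] content_centered_cube[where 'n='n, of "R - 2 * a"] R0
      by (simp_all add: pq rs n_def)
    have cont2: "measure lborel (cbox (p + h) (q + h)) = R ^ n"
    proof -
      have "cbox (p + h) (q + h) \<noteq> {}" "cbox p q \<noteq> {}"
        using s1 s2 R0 by (auto simp: mem_box_cart interval_ne_empty_cart p_def q_def)
      then show ?thesis using cont(1) by (simp add: content_cbox_cart)
    qed
    have sh: "integral (cbox p q) (\<lambda>x. F (x + h)) = integral (cbox (p + h) (q + h)) F"
      using integral_shift_cbox_plus[of p q F h] by (simp add: o_def add.commute)
    have "norm (integral (cbox p q) (\<lambda>x. F (x + h)) - integral (cbox p q) F)
       = norm ((integral (cbox (p + h) (q + h)) F - integral (cbox r s) F) - (integral (cbox p q) F - integral (cbox r s) F))"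
      by (simp add: sh)
    also have "\<dots> \<le> c * (R ^ n - (R - 2 * a) ^ n) + c * (R ^ n - (R - 2 * a) ^ n)"
      using norm_integral_diff_nested_cboxes[OF F(1,2) s1] norm_integral_diff_nested_cboxes[OF F(1,2) s2]
      unfolding cont cont2 by (meson add_mono norm_triangle_ineq4 order_trans)
    finally have *: "norm (integral (cbox p q) (\<lambda>x. F (x + h)) - integral (cbox p q) F) \<le> 2 * c * (R ^ n - (R - 2 * a) ^ n)"
      by simp
    have "norm (cube_mean R (\<lambda>x. F (x + h)) - cube_mean R F) =
       norm (integral (cbox p q) (\<lambda>x. F (x + h)) - integral (cbox p q) F) / R ^ n"
      unfolding cube_mean_def pq scaleR_diff_right[symmetric] norm_scaleR n_def using R0 by (simp add: field_simps)
    also have "\<dots> \<le> 2 * c * (R ^ n - (R - 2 * a) ^ n) / R ^ n"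
      using * R0 by (simp add: divide_right_mono)
    also have "\<dots> = 2 * c * (1 - (1 - 2 * a / R) ^ n)"
    proof -
      have "1 - 2 * a / R = (R - 2 * a) / R" using R0 by (simp add: field_simps)
      then show ?thesis using R0 by (simp add: power_divide diff_divide_distrib[symmetric] field_simps)
    qed
    finally show ?thesis .
  qed
  have "((\<lambda>R::real. 2 * c * (1 - (1 - 2 * a / R) ^ n)) \<longlongrightarrow> 2 * c * (1 - (1 - 0) ^ n)) at_top"
    by (intro tendsto_intros tendsto_divide_0[OF tendsto_const] filterlim_at_top_imp_at_infinity filterlim_ident)
  then have "((\<lambda>R::real. 2 * c * (1 - (1 - 2 * a / R) ^ n)) \<longlongrightarrow> 0) at_top" by simp
  moreover have "\<forall>\<^sub>F R in at_top. norm (cube_mean R (\<lambda>x. F (x + h)) - cube_mean R F) \<le> 2 * c * (1 - (1 - 2 * a / R) ^ n)"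
    using eventually_gt_at_top[of "2 * a"] by eventually_elim (rule bd)
  ultimately show ?thesis
    by (rule Lim_null_comparison[rotated])
qed

lemma has_mean_translate:
  assumes "continuous_on UNIV F" "\<And>x. norm (F x) \<le> c" "has_mean F m"
  shows "has_mean (\<lambda>x. F (x + h)) m"
  using tendsto_add[OF cube_mean_translate_tendsto[OF assms(1,2)] assms(3)[unfolded has_mean_def]]
  by (simp add: has_mean_def)

section \<open>Trigonometric polynomials with frequencies in a given set\<close>

definition wave :: "real^'n \<Rightarrow> real^'n \<Rightarrow> complex"
  where "wave \<xi> x = cis (2 * pi * (\<xi> \<bullet> x))"

lemma norm_wave [simp]: "norm (wave \<xi> x) = 1"
  by (simp add: wave_def)

lemma wave_0 [simp]: "wave 0 x = 1"
  by (simp add: wave_def)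

lemma wave_translate: "wave \<xi> (x + h) = wave \<xi> h * wave \<xi> x"
  by (simp add: wave_def cis_mult inner_add_right algebra_simps)

lemma wave_mult: "wave \<xi> x * wave \<eta> x = wave (\<xi> + \<eta>) x"
  by (simp add: wave_def cis_mult inner_add_left algebra_simps)

lemma cnj_wave: "cnj (wave \<xi> x) = wave (- \<xi>) x"
  by (simp add: wave_def cis_cnj)

lemma continuous_on_wave [continuous_intros]: "continuous_on S (wave \<xi>)"
proof -
  have "wave \<xi> = (\<lambda>x. cis (2 * pi * (\<xi> \<bullet> x)))" by (simp add: wave_def fun_eq_iff)
  then show ?thesis by (simp add: continuous_intros)
qed

lemma norm_cis_diff_le: "norm (cis a - cis b) \<le> \<bar>a - b\<bar>"
proof -
  have "cis a - cis b = cis b * (cis (a - b) - 1)" by (simp add: cis_mult algebra_simps)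
  then have "norm (cis a - cis b) = norm (cis (a - b) - 1)" by (simp add: norm_mult)
  also have "\<dots> = 2 * \<bar>sin ((a - b) / 2)\<bar>"
    using dist_exp_i_1[of "a - b"] by (simp add: cis_conv_exp dist_norm)
  also have "\<dots> \<le> \<bar>a - b\<bar>" using abs_sin_x_le_abs_x[of "(a - b) / 2"] by simp
  finally show ?thesis .
qed

lemma uniformly_continuous_on_wave:
  fixes \<xi> :: "real^'n"
  shows "uniformly_continuous_on UNIV (wave \<xi>)"
proof -
  have "(2 * pi * norm \<xi>)-lipschitz_on UNIV (wave \<xi>)"
  proof (rule lipschitz_onI)
    fix x y :: "real^'n"
    have "norm (wave \<xi> x - wave \<xi> y) \<le> \<bar>2 * pi * (\<xi> \<bullet> x) - 2 * pi * (\<xi> \<bullet> y)\<bar>"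
      unfolding wave_def by (rule norm_cis_diff_le)
    also have "\<dots> = 2 * pi * \<bar>\<xi> \<bullet> (x - y)\<bar>"
      by (simp add: inner_diff_right abs_mult flip: right_diff_distrib)
    also have "\<dots> \<le> 2 * pi * (norm \<xi> * norm (x - y))"
      by (intro mult_left_mono Cauchy_Schwarz_ineq2) auto
    finally show "dist (wave \<xi> x) (wave \<xi> y) \<le> 2 * pi * norm \<xi> * dist x y"
      by (simp add: dist_norm)
  qed simp
  then show ?thesis by (rule lipschitz_on_uniformly_continuous)
qed

text \<open>For \<open>\<xi> \<noteq> 0\<close> some translation multiplies the wave by \<open>-1\<close>, while means do not notice
  translations; so the mean is its own negative.\<close>

lemma has_mean_wave: "has_mean (wave \<xi>) (if \<xi> = 0 then 1 else 0)"
proof (cases "\<xi> = 0")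
  case True
  then have "wave \<xi> = (\<lambda>_. 1)" by (simp add: fun_eq_iff)
  then show ?thesis using True by (simp add: has_mean_const)
next
  case False
  \<comment> \<open>Half a period in the direction of \<open>\<xi>\<close>: here \<open>\<xi> \<bullet> h = 1 / 2\<close>.\<close>
  define h where "h = (1 / (2 * (\<xi> \<bullet> \<xi>))) *\<^sub>R \<xi>"
  have "wave \<xi> h = -1" using False by (simp add: wave_def h_def)
  then have "wave \<xi> (x + h) = - 1 * wave \<xi> x" for x by (simp add: wave_translate)
  then have "((\<lambda>R. cube_mean R (\<lambda>x. - 1 * wave \<xi> x) - cube_mean R (wave \<xi>)) \<longlongrightarrow> 0) at_top"
    using cube_mean_translate_tendsto[of "wave \<xi>" 1 h] by (simp add: continuous_on_wave)
  then have "((\<lambda>R. - (1/2) * (cube_mean R (\<lambda>x. - 1 * wave \<xi> x) - cube_mean R (wave \<xi>))) \<longlongrightarrow> - (1/2) * 0) at_top"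
    by (intro tendsto_intros)
  then show ?thesis unfolding has_mean_def cube_mean_cmult using False by simp
qed

text \<open>Generating trigonometric polynomials term by term makes each closure property and each statement
  about means a short induction; \<open>trig_fun_sum\<close> and \<open>trig_fun_as_sum\<close> recover the finite sums.
  The frequency set is a parameter because the inclusion of spectra is obtained by controlling it.\<close>

inductive_set trig_fun :: "(real^'n) set \<Rightarrow> (real^'n \<Rightarrow> complex) set" for M
  where zero: "(\<lambda>_. 0) \<in> trig_fun M"
  | add_term: "P \<in> trig_fun M \<Longrightarrow> \<xi> \<in> M \<Longrightarrow> (\<lambda>x. P x + a * wave \<xi> x) \<in> trig_fun M"

lemma trig_fun_mono:
  assumes "M \<subseteq> N" "P \<in> trig_fun M" shows "P \<in> trig_fun N"
  using assms(2) by induction (use assms(1) in \<open>auto intro: trig_fun.intros\<close>)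

lemma trig_fun_term: "\<xi> \<in> M \<Longrightarrow> (\<lambda>x. a * wave \<xi> x) \<in> trig_fun M"
  using trig_fun.add_term[OF trig_fun.zero] by fastforce

lemma trig_fun_const: "0 \<in> M \<Longrightarrow> (\<lambda>_. a) \<in> trig_fun M"
  using trig_fun_term[of 0 M a] by simp

lemma trig_fun_add:
  assumes "Q \<in> trig_fun M" "P \<in> trig_fun M"
  shows "(\<lambda>x. P x + Q x) \<in> trig_fun M"
  using assms(1)
proof induction
  case (add_term Q \<xi> a)
  show ?case using trig_fun.add_term[OF add_term.IH add_term.hyps(2), of a] by (simp add: add.assoc)
qed (use assms in simp)

lemma trig_fun_cmult:
  assumes "P \<in> trig_fun M" shows "(\<lambda>x. c * P x) \<in> trig_fun M"
  using assms
proof induction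
  case zero then show ?case by (simp add: trig_fun.zero)
next
  case (add_term P \<xi> a)
  show ?case using trig_fun.add_term[OF add_term.IH add_term.hyps(2), of "c * a"]
    by (simp add: algebra_simps)
qed

lemma trig_fun_diff:
  assumes "P \<in> trig_fun M" "Q \<in> trig_fun M" shows "(\<lambda>x. P x - Q x) \<in> trig_fun M"
  using trig_fun_add[OF trig_fun_cmult[OF assms(2), of "-1"] assms(1)] by simp

lemma trig_fun_mult:
  assumes add: "\<And>\<xi> \<eta>. \<xi> \<in> M \<Longrightarrow> \<eta> \<in> M \<Longrightarrow> \<xi> + \<eta> \<in> M"
    and "P \<in> trig_fun M" "Q \<in> trig_fun M" shows "(\<lambda>x. P x * Q x) \<in> trig_fun M"
proof -
  have 1: "(\<lambda>x. P x * (a * wave \<xi> x)) \<in> trig_fun M" if "\<xi> \<in> M" for \<xi> a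
    using assms(2)
  proof induction
    case zero then show ?case by (simp add: trig_fun.zero)
  next
    case (add_term P \<eta> b)
    then show ?case using trig_fun.add_term[OF add_term.IH add[OF add_term.hyps(2) that], of "a * b"]
      by (simp add: algebra_simps flip: wave_mult)
  qed
  show ?thesis using assms(3)
  proof induction
    case zero then show ?case by (simp add: trig_fun.zero)
  next
    case (add_term Q \<xi> a)
    show ?case using trig_fun_add[OF 1[OF add_term.hyps(2), of a] add_term.IH] by (simp add: distrib_left)
  qed
qed

lemma trig_fun_translate: "P \<in> trig_fun M \<Longrightarrow> (\<lambda>x. P (x + h)) \<in> trig_fun M"
proof (induction rule: trig_fun.induct)
  case (add_term P \<xi> a)
  show ?case using trig_fun.add_term[OF add_term.IH add_term.hyps(2), of "a * wave \<xi> h"]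
    by (simp add: wave_translate mult.assoc)
qed (rule trig_fun.zero)

lemma trig_fun_cnj: "P \<in> trig_fun M \<Longrightarrow> (\<lambda>x. cnj (P x)) \<in> trig_fun (uminus ` M)"
proof (induction rule: trig_fun.induct)
  case (add_term P \<xi> a)
  show ?case using trig_fun.add_term[OF add_term.IH imageI[OF add_term.hyps(2)], of "cnj a"]
    by (simp add: cnj_wave)
qed (simp add: trig_fun.zero)

lemma trig_fun_uniformly_continuous: "P \<in> trig_fun M \<Longrightarrow> uniformly_continuous_on UNIV P"
proof (induction rule: trig_fun.induct)
  case (add_term P \<xi> a)
  have "uniformly_continuous_on UNIV (\<lambda>x. a * wave \<xi> x)"
    by (intro bounded_linear.uniformly_continuous_on[OF bounded_linear_mult_right] uniformly_continuous_on_wave)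
  then show ?case using add_term by (intro uniformly_continuous_on_add)
qed (rule uniformly_continuous_on_const)

lemma trig_fun_continuous: "P \<in> trig_fun M \<Longrightarrow> continuous_on UNIV P"
  by (rule uniformly_continuous_imp_continuous[OF trig_fun_uniformly_continuous])

lemma trig_fun_bounded: "P \<in> trig_fun M \<Longrightarrow> \<exists>c. \<forall>x. norm (P x) \<le> c"
proof (induction rule: trig_fun.induct)
  case (add_term P \<xi> a)
  then obtain c where c: "\<And>x. norm (P x) \<le> c" by auto
  have "norm (P x + a * wave \<xi> x) \<le> c + norm a" for x
    by (rule order_trans[OF norm_triangle_ineq]) (use c[of x] in \<open>simp add: norm_mult\<close>)
  then show ?case by blast
qed auto

lemma trig_fun_has_mean: "P \<in> trig_fun M \<Longrightarrow> \<exists>m. has_mean P m"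
proof (induction rule: trig_fun.induct)
  case zero show ?case using has_mean_const[of 0] by blast
next
  case (add_term P \<xi> a)
  then obtain m where "has_mean P m" by blast
  then have "has_mean (\<lambda>x. P x + a * wave \<xi> x) (m + a * (if \<xi> = 0 then 1 else 0))"
    by (intro has_mean_add has_mean_cmult has_mean_wave continuous_intros trig_fun_continuous[OF add_term.hyps(1)])
  then show ?case by blast
qed

lemma trig_fun_coeff_outside:
  assumes "\<xi> \<notin> M" "P \<in> trig_fun M" shows "has_mean (\<lambda>x. P x * wave (- \<xi>) x) 0"
  using assms(2)
proof induction
  case zero show ?case using has_mean_const[of 0] by simp
next
  case (add_term P \<eta> a)
  have "has_mean (\<lambda>x. P x * wave (- \<xi>) x + a * wave (\<eta> - \<xi>) x) (0 + a * (if \<eta> - \<xi> = 0 then 1 else 0))"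
    by (intro has_mean_add has_mean_cmult has_mean_wave continuous_intros trig_fun_continuous[OF add_term.hyps(1)] add_term.IH)
  moreover have "\<eta> - \<xi> \<noteq> 0" using add_term.hyps assms(1) by auto
  ultimately show ?case by (simp add: algebra_simps wave_mult)
qed

lemma trig_fun_sum:
  assumes "finite \<Lambda>" "\<Lambda> \<subseteq> M" shows "(\<lambda>x. \<Sum>\<xi>\<in>\<Lambda>. a \<xi> * wave \<xi> x) \<in> trig_fun M"
  using assms
proof (induction \<Lambda>)
  case empty show ?case by (simp add: trig_fun.zero)
next
  case (insert \<eta> \<Lambda>)
  then have "(\<lambda>x. (\<Sum>\<xi>\<in>\<Lambda>. a \<xi> * wave \<xi> x) + a \<eta> * wave \<eta> x) \<in> trig_fun M"
    by (intro trig_fun.add_term) auto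
  then show ?case using insert by (simp add: add.commute)
qed

lemma trig_fun_as_sum:
  assumes "P \<in> trig_fun M"
  shows "\<exists>\<Lambda> a. finite \<Lambda> \<and> \<Lambda> \<subseteq> M \<and> P = (\<lambda>x. \<Sum>\<xi>\<in>\<Lambda>. a \<xi> * wave \<xi> x)"
  using assms
proof induction
  case zero show ?case by (rule exI[of _ "{}"]) auto
next
  case (add_term P \<eta> b)
  then obtain \<Lambda> a where \<Lambda>: "finite \<Lambda>" "\<Lambda> \<subseteq> M" "P = (\<lambda>x. \<Sum>\<xi>\<in>\<Lambda>. a \<xi> * wave \<xi> x)" by blast
  define a' where "a' \<xi> = (if \<xi> \<in> \<Lambda> then a \<xi> else 0) + (if \<xi> = \<eta> then b else 0)" for \<xi>
  have "(\<Sum>\<xi>\<in>insert \<eta> \<Lambda>. a' \<xi> * wave \<xi> x) = P x + b * wave \<eta> x" for x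
  proof -
    have "(\<Sum>\<xi>\<in>insert \<eta> \<Lambda>. a' \<xi> * wave \<xi> x) =
       (\<Sum>\<xi>\<in>insert \<eta> \<Lambda>. if \<xi> \<in> \<Lambda> then a \<xi> * wave \<xi> x else 0) + (\<Sum>\<xi>\<in>insert \<eta> \<Lambda>. if \<xi> = \<eta> then b * wave \<xi> x else 0)"
      unfolding sum.distrib[symmetric] by (intro sum.cong) (auto simp: a'_def distrib_right)
    also have "(\<Sum>\<xi>\<in>insert \<eta> \<Lambda>. if \<xi> \<in> \<Lambda> then a \<xi> * wave \<xi> x else 0) = P x"
      unfolding \<Lambda>(3) using \<Lambda>(1) by (intro sum.mono_neutral_cong_right) auto
    finally show ?thesis using \<Lambda>(1) by simp
  qed
  then show ?case using \<Lambda> add_term.hyps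
    by (intro exI[of _ "insert \<eta> \<Lambda>"] exI[of _ a']) auto
qed

lemma trig_polys_iff: "f \<in> trig_polys \<longleftrightarrow> apply_bcontfun f \<in> trig_fun UNIV"
proof
  assume "f \<in> trig_polys"
  then obtain \<Lambda> a where "finite \<Lambda>" "apply_bcontfun f = (\<lambda>x. \<Sum>\<xi>\<in>\<Lambda>. a \<xi> * wave \<xi> x)"
    by (auto simp: trig_polys_def wave_def fun_eq_iff)
  then show "apply_bcontfun f \<in> trig_fun UNIV"
    using trig_fun_sum[of \<Lambda> UNIV a] by simp
next
  assume "apply_bcontfun f \<in> trig_fun UNIV"
  then show "f \<in> trig_polys"
    using trig_fun_as_sum[of "apply_bcontfun f" UNIV] by (fastforce simp: trig_polys_def wave_def)
qed

section \<open>Almost periodic functions and their Bohr coefficients\<close>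

lemma eventually_inverse_Suc_less:
  "e > 0 \<Longrightarrow> \<forall>\<^sub>F k in sequentially. 1 / real (Suc k) < e"
  using order_tendstoD(2)[OF LIMSEQ_inverse_real_of_nat, of e] by (simp add: inverse_eq_divide)

lemma bohr_coeff_eq: "has_mean (\<lambda>x. apply_bcontfun f x * wave (- \<xi>) x) m \<Longrightarrow> bohr_coeff f \<xi> = m"
  unfolding bohr_coeff_def has_mean_def cube_mean_def wave_def inner_minus_left mult_minus_right
  by (rule tendsto_Lim[OF trivial_limit_at_top_linorder])

text \<open>The description of \<open>AP\<close> for plain functions, which, unlike bounded continuous functions, can be
  multiplied and conjugated directly.\<close>

definition almost_periodic :: "(real^'n \<Rightarrow> complex) \<Rightarrow> bool"
  where "almost_periodic F \<longleftrightarrow> (\<forall>e>0. \<exists>P\<in>trig_fun UNIV. \<forall>x. norm (F x - P x) \<le> e)"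

lemma almost_periodicE:
  assumes "almost_periodic F" "e > 0"
  obtains P where "P \<in> trig_fun UNIV" "\<And>x. norm (F x - P x) \<le> e"
  using assms unfolding almost_periodic_def by blast

lemma trig_fun_almost_periodic: "P \<in> trig_fun UNIV \<Longrightarrow> almost_periodic P"
  unfolding almost_periodic_def by (intro allI impI bexI[of _ P]) simp_all

lemma almost_periodic_limit:
  assumes "\<And>e. e > 0 \<Longrightarrow> \<exists>G. almost_periodic G \<and> (\<forall>x. norm (F x - G x) \<le> e)"
  shows "almost_periodic F"
  unfolding almost_periodic_def
proof (intro allI impI)
  fix e :: real assume "e > 0"
  then have e: "e / 2 > 0" by simp
  obtain G where G: "almost_periodic G" "\<And>x. norm (F x - G x) \<le> e / 2" using assms[OF e] by blast
  obtain P where P: "P \<in> trig_fun UNIV" "\<And>x. norm (G x - P x) \<le> e / 2" using almost_periodicE[OF G(1) e] by blast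
  have "norm (F x - P x) \<le> e" for x
    using norm_triangle_ineq[of "F x - G x" "G x - P x"] G(2)[of x] P(2)[of x] by simp
  then show "\<exists>P\<in>trig_fun UNIV. \<forall>x. norm (F x - P x) \<le> e" using P(1) by blast
qed

lemma almost_periodic_bounded:
  assumes "almost_periodic F" obtains c where "c > 0" "\<And>x. norm (F x) \<le> c"
proof -
  obtain P where P: "P \<in> trig_fun UNIV" "\<And>x. norm (F x - P x) \<le> 1"
    using almost_periodicE[OF assms, of 1] by auto
  obtain c where c: "\<And>x. norm (P x) \<le> c" using trig_fun_bounded[OF P(1)] by blast
  have "norm (F x) \<le> \<bar>c\<bar> + 1" for x
    using norm_triangle_ineq[of "F x - P x" "P x"] P(2)[of x] c[of x] by simp
  then show ?thesis by (intro that[of "\<bar>c\<bar> + 1"]) auto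
qed

lemma almost_periodic_continuous:
  assumes "almost_periodic F" shows "continuous_on UNIV F"
proof -
  have "\<exists>P. P \<in> trig_fun UNIV \<and> (\<forall>x. norm (F x - P x) \<le> 1 / real (Suc k))" for k
    using almost_periodicE[OF assms, of "1 / real (Suc k)"] by (metis of_nat_0_less_iff zero_less_Suc zero_less_divide_1_iff)
  then obtain P where P: "\<And>k. P k \<in> trig_fun UNIV" "\<And>k x. norm (F x - P k x) \<le> 1 / real (Suc k)" by metis
  have "uniform_limit UNIV P F sequentially"
  proof (rule uniform_limitI)
    fix e :: real assume "e > 0"
    then have "\<forall>\<^sub>F k in sequentially. 1 / real (Suc k) < e" by (rule eventually_inverse_Suc_less)
    then show "\<forall>\<^sub>F k in sequentially. \<forall>x\<in>UNIV. dist (P k x) (F x) < e"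
    proof eventually_elim
      case (elim k)
      then show ?case using P(2)[of _ k] by (auto simp: dist_norm norm_minus_commute intro: le_less_trans)
    qed
  qed
  then show ?thesis
    by (rule uniform_limit_theorem[OF always_eventually[OF allI[OF trig_fun_continuous[OF P(1)]]]]) simp
qed

lemma almost_periodic_translate:
  assumes "almost_periodic F" shows "almost_periodic (\<lambda>x. F (x + h))"
  unfolding almost_periodic_def
proof (intro allI impI)
  fix e :: real assume "e > 0"
  then obtain P where P: "P \<in> trig_fun UNIV" "\<And>x. norm (F x - P x) \<le> e" using almost_periodicE[OF assms] by blast
  then show "\<exists>P\<in>trig_fun UNIV. \<forall>x. norm (F (x + h) - P x) \<le> e"
    by (intro bexI[OF _ trig_fun_translate[OF P(1), of h]]) auto
qed

lemma almost_periodic_cnj: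
  assumes "almost_periodic F" shows "almost_periodic (\<lambda>x. cnj (F x))"
  unfolding almost_periodic_def
proof (intro allI impI)
  fix e :: real assume "e > 0"
  then obtain P where P: "P \<in> trig_fun UNIV" "\<And>x. norm (F x - P x) \<le> e" using almost_periodicE[OF assms] by blast
  have "(\<lambda>x. cnj (P x)) \<in> trig_fun UNIV" using trig_fun_cnj[OF P(1)] by simp
  moreover have "norm (cnj (F x) - cnj (P x)) \<le> e" for x
    using P(2)[of x] by (simp flip: complex_cnj_diff)
  ultimately show "\<exists>P\<in>trig_fun UNIV. \<forall>x. norm (cnj (F x) - P x) \<le> e" by (intro bexI) auto
qed

lemma almost_periodic_diff:
  assumes "almost_periodic F" "almost_periodic G" shows "almost_periodic (\<lambda>x. F x - G x)"
  unfolding almost_periodic_def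
proof (intro allI impI)
  fix e :: real assume "e > 0"
  then have e: "e / 2 > 0" by simp
  obtain P where P: "P \<in> trig_fun UNIV" "\<And>x. norm (F x - P x) \<le> e / 2" using almost_periodicE[OF assms(1) e] by blast
  obtain Q where Q: "Q \<in> trig_fun UNIV" "\<And>x. norm (G x - Q x) \<le> e / 2" using almost_periodicE[OF assms(2) e] by blast
  have "norm ((F x - G x) - (P x - Q x)) \<le> e" for x
    using norm_triangle_ineq4[of "F x - P x" "G x - Q x"] P(2)[of x] Q(2)[of x] by (simp add: algebra_simps)
  then show "\<exists>P\<in>trig_fun UNIV. \<forall>x. norm ((F x - G x) - P x) \<le> e"
    by (intro bexI[OF _ trig_fun_diff[OF P(1) Q(1)]]) auto
qed

lemma almost_periodic_mult:
  assumes F: "almost_periodic F" and G: "almost_periodic G" shows "almost_periodic (\<lambda>x. F x * G x)"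
  unfolding almost_periodic_def
proof (intro allI impI)
  fix e :: real assume e: "e > 0"
  obtain c where c: "c > 0" "\<And>x. norm (F x) \<le> c" using almost_periodic_bounded[OF F] by blast
  obtain Q where Q: "Q \<in> trig_fun UNIV" "\<And>x. norm (G x - Q x) \<le> e / (2 * c)"
    using almost_periodicE[OF G, of "e / (2 * c)"] e c(1) by auto
  obtain d where d: "d > 0" "\<And>x. norm (Q x) \<le> d"
    using almost_periodic_bounded[OF trig_fun_almost_periodic[OF Q(1)]] by blast
  obtain P where P: "P \<in> trig_fun UNIV" "\<And>x. norm (F x - P x) \<le> e / (2 * d)"
    using almost_periodicE[OF F, of "e / (2 * d)"] e d(1) by auto
  have "norm (F x * G x - P x * Q x) \<le> e" for x
  proof -
    have "norm (F x * G x - P x * Q x) = norm (F x * (G x - Q x) + (F x - P x) * Q x)"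
      by (simp add: algebra_simps)
    also have "\<dots> \<le> norm (F x) * norm (G x - Q x) + norm (F x - P x) * norm (Q x)"
      by (metis norm_mult norm_triangle_ineq)
    also have "\<dots> \<le> c * (e / (2 * c)) + e / (2 * d) * d"
      using c d P(2)[of x] Q(2)[of x] e by (intro add_mono mult_mono) auto
    also have "\<dots> = e" using c(1) d(1) by simp
    finally show ?thesis .
  qed
  then show "\<exists>P\<in>trig_fun UNIV. \<forall>x. norm (F x * G x - P x) \<le> e"
    by (intro bexI[OF _ trig_fun_mult[OF _ P(1) Q(1)]]) auto
qed

lemma almost_periodic_wave: "almost_periodic (wave \<xi>)"
  using trig_fun_almost_periodic[OF trig_fun_term[of \<xi> UNIV 1]] by simp

text \<open>Averaging is a contraction for the uniform norm, uniformly in \<open>R\<close>, so the means of approximating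
  trigonometric polynomials form a Cauchy sequence and the two limits may be interchanged.\<close>

lemma almost_periodic_has_mean:
  fixes F :: "real^'n \<Rightarrow> complex"
  assumes F: "almost_periodic F" shows "\<exists>m. has_mean F m"
proof -
  have "\<exists>P. P \<in> trig_fun UNIV \<and> (\<forall>x. norm (F x - P x) \<le> 1 / real (Suc k))" for k
    using almost_periodicE[OF assms, of "1 / real (Suc k)"] by (metis of_nat_0_less_iff zero_less_Suc zero_less_divide_1_iff)
  then obtain P where P: "\<And>k. P k \<in> trig_fun UNIV" "\<And>k x. norm (F x - P k x) \<le> 1 / real (Suc k)" by metis
  obtain m where m: "\<And>k. has_mean (P k) (m k)" using trig_fun_has_mean[OF P(1)] by metis
  have contP: "continuous_on UNIV (P k)" for k by (rule trig_fun_continuous[OF P(1)])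
  have contF: "continuous_on UNIV F" by (rule almost_periodic_continuous[OF F])
  have *: "norm (m j - m k) \<le> 1 / real (Suc j) + 1 / real (Suc k)" for j k
  proof (rule has_mean_norm_le[OF _ _ has_mean_diff[OF contP contP m m]])
    show "norm (P j x - P k x) \<le> 1 / real (Suc j) + 1 / real (Suc k)" for x
      using norm_triangle_ineq4[of "F x - P k x" "F x - P j x"] P(2)[of x k] P(2)[of x j] by simp
  qed (intro continuous_intros contP)
  have "Cauchy m"
  proof (rule metric_CauchyI)
    fix e :: real assume e: "e > 0"
    then have "\<forall>\<^sub>F k in sequentially. 1 / real (Suc k) < e / 2" by (intro eventually_inverse_Suc_less) simp
    then obtain N where N: "\<And>k. k \<ge> N \<Longrightarrow> 1 / real (Suc k) < e / 2" unfolding eventually_sequentially by blast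
    have "dist (m j) (m k) < e" if "j \<ge> N" "k \<ge> N" for j k
      using *[of j k] N[OF that(1)] N[OF that(2)] by (simp add: dist_norm)
    then show "\<exists>N. \<forall>j\<ge>N. \<forall>k\<ge>N. dist (m j) (m k) < e" by blast
  qed
  then obtain l where l: "m \<longlonglongrightarrow> l" using Cauchy_convergent convergentD by blast
  have "((\<lambda>R. cube_mean R F) \<longlongrightarrow> l) at_top"
  proof (rule swap_uniform_limit'[OF always_eventually l, where S = "{0<..}"])
    show "\<forall>k. ((\<lambda>R. cube_mean R (P k)) \<longlongrightarrow> m k) at_top" using m by (simp add: has_mean_def)
    show "uniform_limit {0<..} (\<lambda>k R. cube_mean R (P k)) (\<lambda>R. cube_mean R F) sequentially"
    proof (rule uniform_limitI)
      fix e :: real assume "e > 0"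
      then have "\<forall>\<^sub>F k in sequentially. 1 / real (Suc k) < e" by (rule eventually_inverse_Suc_less)
      then show "\<forall>\<^sub>F k in sequentially. \<forall>R\<in>{0<..}. dist (cube_mean R (P k)) (cube_mean R F) < e"
      proof eventually_elim
        case (elim k)
        have "norm (cube_mean R (\<lambda>x. F x - P k x)) \<le> 1 / real (Suc k)" if "R > 0" for R
          by (intro norm_cube_mean_le continuous_intros contF contP P(2) that)
        with elim show ?case by (force simp: cube_mean_diff[OF contF contP] dist_norm norm_minus_commute)
      qed
    qed
  qed (auto intro: eventually_gt_at_top)
  then show ?thesis unfolding has_mean_def by blast
qed

text \<open>Sort the points \<open>h\<close> into finitely many classes according to which of \<open>m\<close> equal parts of the unit
  interval contains the fractional part of \<open>\<xi> \<bullet> h\<close>, for each \<open>\<xi>\<close>; one representative of each class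
  suffices. This is the total boundedness of the torus, from which that of the set of translates of an
  almost periodic function follows.\<close>

lemma waves_pigeonhole:
  fixes \<Lambda> :: "(real^'n) set"
  assumes "finite \<Lambda>" "e > 0"
  shows "\<exists>N. finite N \<and> (\<forall>h. \<exists>k\<in>N. \<forall>\<xi>\<in>\<Lambda>. norm (wave \<xi> h - wave \<xi> k) \<le> e)"
proof -
  obtain m :: nat where m: "m > 0" "2 * pi / e < real m"
    using reals_Archimedean2[of "max 1 (2 * pi / e)"] by (metis gr0I max_less_iff_conj not_one_less_zero of_nat_0)
  define q where "q h = restrict (\<lambda>\<xi>. \<lfloor>real m * frac (\<xi> \<bullet> h)\<rfloor>) \<Lambda>" for h
  have "q h \<in> \<Lambda> \<rightarrow>\<^sub>E {0..int m}" for h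
  proof -
    have "0 \<le> \<lfloor>real m * frac (\<xi> \<bullet> h)\<rfloor>" "\<lfloor>real m * frac (\<xi> \<bullet> h)\<rfloor> \<le> int m" for \<xi>
    proof -
      have "real m * frac (\<xi> \<bullet> h) \<le> real m * 1"
        using frac_lt_1[of "\<xi> \<bullet> h"] by (intro mult_left_mono) auto
      then show "\<lfloor>real m * frac (\<xi> \<bullet> h)\<rfloor> \<le> int m" by linarith
    qed simp
    then show ?thesis by (auto simp: q_def)
  qed
  then have fin: "finite (range q)"
    by (intro finite_subset[OF _ finite_PiE[OF assms(1), of "\<lambda>_. {0..int m}"]]) auto
  have "\<exists>k\<in>inv q ` range q. \<forall>\<xi>\<in>\<Lambda>. norm (wave \<xi> h - wave \<xi> k) \<le> e" for h
  proof (intro bexI ballI)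
    let ?k = "inv q (q h)"
    show "?k \<in> inv q ` range q" by simp
    have qk: "q ?k = q h" by (simp add: f_inv_into_f)
    fix \<xi> assume "\<xi> \<in> \<Lambda>"
    then have fl: "\<lfloor>real m * frac (\<xi> \<bullet> h)\<rfloor> = \<lfloor>real m * frac (\<xi> \<bullet> ?k)\<rfloor>"
      using fun_cong[OF qk, of \<xi>] by (simp add: q_def)
    have "\<bar>real m * frac (\<xi> \<bullet> h) - real m * frac (\<xi> \<bullet> ?k)\<bar> \<le> 1"
      using fl by linarith
    then have d: "real m * \<bar>frac (\<xi> \<bullet> h) - frac (\<xi> \<bullet> ?k)\<bar> \<le> 1"
      by (simp add: abs_mult flip: right_diff_distrib)
    have w: "wave \<xi> y = cis (2 * pi * frac (\<xi> \<bullet> y))" for y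
    proof -
      have "\<xi> \<bullet> y = frac (\<xi> \<bullet> y) + of_int \<lfloor>\<xi> \<bullet> y\<rfloor>" by (simp add: frac_def)
      then have "wave \<xi> y = cis (2 * pi * frac (\<xi> \<bullet> y)) * cis (2 * pi * of_int \<lfloor>\<xi> \<bullet> y\<rfloor>)"
        unfolding wave_def by (metis cis_mult distrib_left)
      then show ?thesis by simp
    qed
    have "norm (wave \<xi> h - wave \<xi> ?k) \<le> 2 * pi * \<bar>frac (\<xi> \<bullet> h) - frac (\<xi> \<bullet> ?k)\<bar>"
      using norm_cis_diff_le[of "2 * pi * frac (\<xi> \<bullet> h)" "2 * pi * frac (\<xi> \<bullet> ?k)"]
      by (simp add: w abs_mult flip: right_diff_distrib)
    also have "\<dots> \<le> (e * real m) * \<bar>frac (\<xi> \<bullet> h) - frac (\<xi> \<bullet> ?k)\<bar>"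
      using m assms(2) by (intro mult_right_mono) (auto simp: field_simps)
    also have "\<dots> = e * (real m * \<bar>frac (\<xi> \<bullet> h) - frac (\<xi> \<bullet> ?k)\<bar>)" by simp
    also have "\<dots> \<le> e * 1" using d assms(2) by (intro mult_left_mono) auto
    finally show "norm (wave \<xi> h - wave \<xi> ?k) \<le> e" by simp
  qed
  then show ?thesis using fin by (intro exI[of _ "inv q ` range q"]) auto
qed

lemma almost_periodic_translates_totally_bounded:
  fixes F :: "real^'n \<Rightarrow> complex"
  assumes F: "almost_periodic F" and "e > 0"
  shows "\<exists>N. finite N \<and> (\<forall>h. \<exists>k\<in>N. \<forall>x. norm (F (x + h) - F (x + k)) \<le> e)"
proof -
  have e: "e / 3 > 0" using assms by simp
  obtain P where P: "P \<in> trig_fun UNIV" "\<And>x. norm (F x - P x) \<le> e / 3" using almost_periodicE[OF F e] by blast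
  obtain \<Lambda> a where \<Lambda>: "finite \<Lambda>" "P = (\<lambda>x. \<Sum>\<xi>\<in>\<Lambda>. a \<xi> * wave \<xi> x)" using trig_fun_as_sum[OF P(1)] by blast
  define A where "A = 1 + (\<Sum>\<xi>\<in>\<Lambda>. norm (a \<xi>))"
  have A: "A > 0" unfolding A_def by (simp add: add_pos_nonneg sum_nonneg)
  obtain N where N: "finite N" "\<And>h. \<exists>k\<in>N. \<forall>\<xi>\<in>\<Lambda>. norm (wave \<xi> h - wave \<xi> k) \<le> e / 3 / A"
    using waves_pigeonhole[OF \<Lambda>(1), of "e / 3 / A"] e A by auto
  have "\<exists>k\<in>N. \<forall>x. norm (F (x + h) - F (x + k)) \<le> e" for h
  proof -
    obtain k where k: "k \<in> N" "\<And>\<xi>. \<xi> \<in> \<Lambda> \<Longrightarrow> norm (wave \<xi> h - wave \<xi> k) \<le> e / 3 / A" using N(2)[of h] by blast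
    have "norm (F (x + h) - F (x + k)) \<le> e" for x
    proof -
      have "norm (P (x + h) - P (x + k)) = norm (\<Sum>\<xi>\<in>\<Lambda>. a \<xi> * wave \<xi> x * (wave \<xi> h - wave \<xi> k))"
        by (simp add: \<Lambda>(2) wave_translate algebra_simps flip: sum_subtractf)
      also have "\<dots> \<le> (\<Sum>\<xi>\<in>\<Lambda>. norm (a \<xi>) * (e / 3 / A))"
        by (intro sum_norm_le) (simp only: norm_mult norm_wave mult_1_right mult_left_mono[OF k(2)] norm_ge_zero)
      also have "\<dots> = (A - 1) * (e / 3 / A)" by (simp only: sum_distrib_right[symmetric]) (simp add: A_def)
      also have "\<dots> \<le> A * (e / 3 / A)" using e A by (intro mult_right_mono) auto
      also have "\<dots> = e / 3" using A by simp
      finally have "norm (P (x + h) - P (x + k)) \<le> e / 3" .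
      moreover have "norm (F (x + h) - F (x + k)) \<le> norm (F (x + h) - P (x + h)) + norm (P (x + h) - P (x + k)) + norm (F (x + k) - P (x + k))"
        using norm_triangle_ineq4[of "F (x + h) - P (x + h) + (P (x + h) - P (x + k))" "F (x + k) - P (x + k)"]
          norm_triangle_ineq[of "F (x + h) - P (x + h)" "P (x + h) - P (x + k)"] by simp
      ultimately show ?thesis using P(2)[of "x + h"] P(2)[of "x + k"] by linarith
    qed
    then show ?thesis using k(1) by blast
  qed
  then show ?thesis using N(1) by blast
qed

lemma has_mean_sum:
  assumes "finite N" "\<And>k. k \<in> N \<Longrightarrow> continuous_on UNIV (F k)" "\<And>k. k \<in> N \<Longrightarrow> has_mean (F k) (m k)"
  shows "has_mean (\<lambda>x. \<Sum>k\<in>N. F k x) (\<Sum>k\<in>N. m k)"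
  using assms
proof (induction N)
  case empty then show ?case by (simp add: has_mean_const)
next
  case (insert k N)
  then have "has_mean (\<lambda>x. F k x + (\<Sum>k\<in>N. F k x)) (m k + (\<Sum>k\<in>N. m k))"
    by (intro has_mean_add continuous_on_sum) auto
  then show ?case using insert by simp
qed

text \<open>If \<open>g x0 > 0\<close>, total boundedness of the translates yields finitely many translates of \<open>g\<close> of which,
  at every point, at least one is no smaller than \<open>g x0 / 2\<close>. Their sum is bounded below by \<open>g x0 / 2\<close>, but
  its mean is a multiple of the mean of \<open>g\<close>.\<close>

lemma almost_periodic_nonneg_mean_zero:
  fixes g :: "real^'n \<Rightarrow> real"
  assumes ap: "almost_periodic (\<lambda>x. of_real (g x))" and pos: "\<And>x. g x \<ge> 0"
    and mean: "has_mean (\<lambda>x. of_real (g x)) 0"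
  shows "g x0 = 0"
proof (rule ccontr)
  assume "g x0 \<noteq> 0"
  then have d: "g x0 > 0" using pos[of x0] by simp
  let ?F = "\<lambda>x. complex_of_real (g x)"
  have cont: "continuous_on UNIV (\<lambda>x. ?F (x + k))" for k
    by (rule almost_periodic_continuous[OF almost_periodic_translate[OF ap]])
  obtain c where c: "\<And>x. norm (?F x) \<le> c" using almost_periodic_bounded[OF ap] by blast
  obtain N where N: "finite N" "\<And>h. \<exists>k\<in>N. \<forall>x. norm (?F (x + h) - ?F (x + k)) \<le> g x0 / 2"
    using almost_periodic_translates_totally_bounded[OF ap, of "g x0 / 2"] d by auto
  define S where "S z = (\<Sum>k\<in>N. g (z + k))" for z
  define C where "C = real (card N) * c"
  have upper: "S z \<le> C" for z
    unfolding S_def C_def using c pos by (intro sum_bounded_above) (simp add: abs_of_nonneg)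
  have lower: "g x0 / 2 \<le> S z" for z
  proof -
    obtain k where k: "k \<in> N" "norm (?F (z + (x0 - z)) - ?F (z + k)) \<le> g x0 / 2" using N(2)[of "x0 - z"] by blast
    have "\<bar>g x0 - g (z + k)\<bar> \<le> g x0 / 2" using k(2) by (simp flip: of_real_diff)
    then have "g x0 / 2 \<le> g (z + k)" by (simp only: abs_le_iff) linarith
    also have "\<dots> \<le> S z" unfolding S_def by (rule member_le_sum[OF k(1) _ N(1)]) (rule pos)
    finally show ?thesis .
  qed
  have "has_mean (\<lambda>x. \<Sum>k\<in>N. ?F (x + k)) (\<Sum>k\<in>N. 0)"
    by (intro has_mean_sum N(1) cont has_mean_translate[OF almost_periodic_continuous[OF ap] c mean])
  then have m: "has_mean (\<lambda>x. of_real (S x)) 0" by (simp add: S_def)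
  have contS: "continuous_on UNIV (\<lambda>x. complex_of_real (S x))"
    unfolding S_def of_real_sum by (intro continuous_on_sum cont)
  \<comment> \<open>As \<open>S\<close> takes values in \<open>[g x0 / 2, C]\<close>, the norm bound for means applied to \<open>C - S\<close> replaces
    a monotonicity statement about real means.\<close>
  have "norm (of_real C - 0 :: complex) \<le> C - g x0 / 2"
  proof (rule has_mean_norm_le[OF _ _ has_mean_diff[OF continuous_on_const contS has_mean_const m]])
    show "norm (of_real C - of_real (S x) :: complex) \<le> C - g x0 / 2" for x
      using upper[of x] lower[of x] by (simp flip: of_real_diff)
  qed (intro continuous_intros contS)
  then show False using d by simp
qed

text \<open>Such an \<open>F\<close> is orthogonal to all trigonometric polynomials with respect to the mean value, hence by
  approximation to itself. So the nonnegative function \<open>\<bar>F\<bar>\<^sup>2\<close> has mean zero and vanishes.\<close>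

lemma almost_periodic_zero_coeffs:
  fixes F :: "real^'n \<Rightarrow> complex"
  assumes F: "almost_periodic F" and zero: "\<And>\<xi>. has_mean (\<lambda>x. F x * wave (- \<xi>) x) 0"
  shows "F x = 0"
proof -
  have contF: "continuous_on UNIV F" by (rule almost_periodic_continuous[OF F])
  have orth: "has_mean (\<lambda>x. F x * cnj (P x)) 0" if "P \<in> trig_fun UNIV" for P
    using that
  proof induction
    case zero show ?case using has_mean_const[of 0] by simp
  next
    case (add_term P \<xi> a)
    have "has_mean (\<lambda>x. F x * cnj (P x) + cnj a * (F x * wave (- \<xi>) x)) (0 + cnj a * 0)"
      by (intro has_mean_add has_mean_cmult zero add_term.IH continuous_intros contF trig_fun_continuous[OF add_term.hyps(1)])
    then show ?case by (simp add: cnj_wave algebra_simps)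
  qed
  let ?Q = "\<lambda>x. F x * cnj (F x)"
  have apQ: "almost_periodic ?Q" by (intro almost_periodic_mult almost_periodic_cnj F)
  then obtain m where m: "has_mean ?Q m" using almost_periodic_has_mean by blast
  obtain c where c: "c > 0" "\<And>x. norm (F x) \<le> c" using almost_periodic_bounded[OF F] by blast
  have "norm m \<le> 0 + e" if e: "e > 0" for e
  proof -
    obtain P where P: "P \<in> trig_fun UNIV" "\<And>x. norm (F x - P x) \<le> e / c"
      using almost_periodicE[OF F, of "e / c"] e c(1) by auto
    note contP = trig_fun_continuous[OF P(1)]
    have "norm (m - 0) \<le> e"
    proof (rule has_mean_norm_le[OF _ _ has_mean_diff[OF _ _ m orth[OF P(1)]]])
      fix x
      have "norm (?Q x - F x * cnj (P x)) = norm (F x) * norm (F x - P x)"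
        by (metis complex_cnj_diff complex_mod_cnj norm_mult right_diff_distrib)
      also have "\<dots> \<le> c * (e / c)" using c P(2) by (intro mult_mono) auto
      finally show "norm (?Q x - F x * cnj (P x)) \<le> e" using c(1) by simp
    qed (intro continuous_intros contF contP)+
    then show ?thesis by simp
  qed
  then have "m = 0" using field_le_epsilon[of "norm m" 0] by simp
  moreover have "?Q = (\<lambda>x. of_real ((cmod (F x))\<^sup>2))" by (simp add: complex_norm_square[symmetric])
  ultimately have "(cmod (F x))\<^sup>2 = 0"
    using almost_periodic_nonneg_mean_zero[of "\<lambda>x. (cmod (F x))\<^sup>2" x] apQ m by simp
  then show ?thesis by simp
qed

lemma norm_diff_le_dist_bcontfun:
  fixes f g :: "'a::topological_space \<Rightarrow>\<^sub>C 'b::real_normed_vector"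
  shows "norm (apply_bcontfun f x - apply_bcontfun g x) \<le> dist f g"
  using dist_bounded[of f x g] by (simp add: dist_norm)

lemma bohr_coeff_has_mean:
  assumes "almost_periodic (apply_bcontfun f)"
  shows "has_mean (\<lambda>x. apply_bcontfun f x * wave (- \<xi>) x) (bohr_coeff f \<xi>)"
  using almost_periodic_has_mean[OF almost_periodic_mult[OF assms almost_periodic_wave]] bohr_coeff_eq
  by metis

lemma bohr_coeff_dist_le:
  assumes "almost_periodic (apply_bcontfun f)" "almost_periodic (apply_bcontfun g)"
  shows "norm (bohr_coeff f \<xi> - bohr_coeff g \<xi>) \<le> dist f g"
proof (rule has_mean_norm_le[OF _ _ has_mean_diff[OF _ _ bohr_coeff_has_mean[OF assms(1)] bohr_coeff_has_mean[OF assms(2)]]])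
  fix x
  show "norm (apply_bcontfun f x * wave (- \<xi>) x - apply_bcontfun g x * wave (- \<xi>) x) \<le> dist f g"
    using norm_diff_le_dist_bcontfun[of f x g] by (simp add: norm_mult flip: left_diff_distrib)
qed (intro continuous_intros continuous_on_apply_bcontfun)+

lemma bohr_coeff_inject:
  assumes f: "almost_periodic (apply_bcontfun f)" and g: "almost_periodic (apply_bcontfun g)"
    and eq: "\<And>\<xi>. bohr_coeff f \<xi> = bohr_coeff g \<xi>"
  shows "f = g"
proof (rule bcontfun_eqI)
  fix x
  have "has_mean (\<lambda>x. (apply_bcontfun f x - apply_bcontfun g x) * wave (- \<xi>) x) 0" for \<xi>
    using has_mean_diff[OF _ _ bohr_coeff_has_mean[OF f, of \<xi>] bohr_coeff_has_mean[OF g, of \<xi>]]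
    by (simp add: eq left_diff_distrib continuous_intros)
  from almost_periodic_zero_coeffs[OF almost_periodic_diff[OF f g] this, of x]
  show "apply_bcontfun f x = apply_bcontfun g x" by simp
qed

definition translate :: "real^'n \<Rightarrow> ((real^'n) \<Rightarrow>\<^sub>C 'b::real_normed_vector) \<Rightarrow> ((real^'n) \<Rightarrow>\<^sub>C 'b)"
  where "translate h f = Bcontfun (\<lambda>x. apply_bcontfun f (x + h))"

lemma apply_translate [simp]: "apply_bcontfun (translate h f) x = apply_bcontfun f (x + h)"
proof -
  have "(\<lambda>x. apply_bcontfun f (x + h)) \<in> bcontfun"
    using norm_bounded[of f]
    by (intro bcontfun_normI[of _ "norm f"] continuous_on_compose2[OF continuous_on_apply_bcontfun[of UNIV f]])
       (auto intro!: continuous_intros)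
  then show ?thesis by (simp add: translate_def Bcontfun_inverse)
qed

lemma bohr_coeff_translate:
  assumes f: "almost_periodic (apply_bcontfun f)"
  shows "bohr_coeff (translate h f) \<xi> = wave \<xi> h * bohr_coeff f \<xi>"
proof (rule bohr_coeff_eq)
  let ?G = "\<lambda>x. apply_bcontfun f x * wave (- \<xi>) x"
  have ap: "almost_periodic ?G" by (rule almost_periodic_mult[OF f almost_periodic_wave])
  obtain c where c: "\<And>x. norm (?G x) \<le> c" using almost_periodic_bounded[OF ap] by blast
  have "has_mean (\<lambda>x. wave \<xi> h * ?G (x + h)) (wave \<xi> h * bohr_coeff f \<xi>)"
    by (rule has_mean_cmult[OF has_mean_translate[OF almost_periodic_continuous[OF ap] c bohr_coeff_has_mean[OF f]]])
  moreover have "wave \<xi> h * ?G (x + h) = apply_bcontfun f (x + h) * wave (- \<xi>) x" for x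
    using wave_mult[of \<xi> h "- \<xi>"] by (simp add: wave_translate algebra_simps)
  ultimately show "has_mean (\<lambda>x. apply_bcontfun (translate h f) x * wave (- \<xi>) x) (wave \<xi> h * bohr_coeff f \<xi>)"
    by simp
qed

text \<open>The closure in \<open>AP\<close> is taken inside the subspace \<open>BUC\<close>, which is why membership in \<open>BUC\<close> appears
  in the converse.\<close>

lemma AP_imp_almost_periodic:
  assumes "f \<in> AP" shows "almost_periodic (apply_bcontfun f)"
  unfolding almost_periodic_def
proof (intro allI impI)
  fix e :: real assume "e > 0"
  have "f \<in> closure trig_polys"
    using assms closure_of_mono[of "BUC \<inter> trig_polys" trig_polys euclidean]
    by (auto simp: AP_def closure_of_subtopology)
  then obtain p where p: "p \<in> trig_polys" "dist p f < e" using \<open>e > 0\<close> closure_approachable by blast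
  have "norm (apply_bcontfun f x - apply_bcontfun p x) \<le> e" for x
    using norm_diff_le_dist_bcontfun[of f x p] p(2) by (simp add: dist_commute)
  then show "\<exists>P\<in>trig_fun UNIV. \<forall>x. norm (apply_bcontfun f x - P x) \<le> e"
    using p(1) by (auto simp: trig_polys_iff)
qed

lemma almost_periodic_imp_AP:
  assumes ap: "almost_periodic (apply_bcontfun f)" and f: "f \<in> BUC"
  shows "f \<in> AP"
proof -
  have "f \<in> closure (BUC \<inter> trig_polys)"
    unfolding closure_approachable
  proof (intro allI impI)
    fix e :: real assume "e > 0"
    then have e: "e / 2 > 0" by simp
    obtain P where P: "P \<in> trig_fun UNIV" "\<And>x. norm (apply_bcontfun f x - P x) \<le> e / 2"
      using almost_periodicE[OF ap e] by blast
    obtain c where "\<And>x. norm (P x) \<le> c" using trig_fun_bounded[OF P(1)] by blast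
    then have "P \<in> bcontfun" by (intro bcontfun_normI trig_fun_continuous[OF P(1)])
    then have app: "apply_bcontfun (Bcontfun P) = P" by (simp add: Bcontfun_inverse)
    have "dist f (Bcontfun P) \<le> e / 2" by (rule dist_bound) (simp only: app dist_norm P(2))
    then have "dist (Bcontfun P) f < e" using \<open>e > 0\<close> by (simp add: dist_commute)
    moreover have "Bcontfun P \<in> BUC \<inter> trig_polys"
      using P(1) trig_fun_uniformly_continuous[OF P(1)] by (simp add: BUC_def trig_polys_iff app)
    ultimately show "\<exists>p\<in>BUC \<inter> trig_polys. dist p f < e" by blast
  qed
  then show ?thesis using f by (simp add: AP_def closure_of_subtopology)
qed

section \<open>Functions that vary no more than an almost periodic function\<close>

text \<open>The hull of \<open>f\<close> in the sense of almost periodic function theory.\<close>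

definition orbit_closure :: "((real^'n) \<Rightarrow>\<^sub>C complex) \<Rightarrow> ((real^'n) \<Rightarrow>\<^sub>C complex) set"
  where "orbit_closure f = closure (range (\<lambda>h. translate h f))"

lemma translate_in_orbit_closure: "translate h f \<in> orbit_closure f"
  unfolding orbit_closure_def by (rule subsetD[OF closure_subset rangeI])

text \<open>Bochner's characterisation: the translates of an almost periodic function are totally bounded
  in the complete space of bounded continuous functions.\<close>

lemma compact_orbit_closure:
  assumes f: "almost_periodic (apply_bcontfun f)"
  shows "compact (orbit_closure f)"
  unfolding compact_eq_totally_bounded
proof (intro conjI allI impI)
  show "complete (orbit_closure f)" by (simp add: complete_eq_closed orbit_closure_def)
  fix e :: real assume e: "e > 0"
  obtain N where N: "finite N"
      "\<And>h. \<exists>k\<in>N. \<forall>x. norm (apply_bcontfun f (x + h) - apply_bcontfun f (x + k)) \<le> e / 2"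
    using almost_periodic_translates_totally_bounded[OF f, of "e / 2"] e by auto
  have "translate h f \<in> (\<Union>k\<in>N. cball (translate k f) (e / 2))" for h
  proof -
    obtain k where k: "k \<in> N" "\<And>x. norm (apply_bcontfun f (x + h) - apply_bcontfun f (x + k)) \<le> e / 2"
      using N(2)[of h] by blast
    have "dist (translate h f) (translate k f) \<le> e / 2"
      by (rule dist_bound) (simp only: apply_translate dist_norm k(2))
    then show ?thesis using k(1) by (auto simp: dist_commute)
  qed
  then have "orbit_closure f \<subseteq> (\<Union>k\<in>N. cball (translate k f) (e / 2))"
    unfolding orbit_closure_def by (intro closure_minimal closed_UN N(1)) auto
  also have "\<dots> \<subseteq> (\<Union>\<phi>\<in>(\<lambda>k. translate k f) ` N. ball \<phi> e)" using e by force
  finally show "\<exists>k. finite k \<and> orbit_closure f \<subseteq> (\<Union>x\<in>k. ball x e)" using N(1) by blast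
qed

lemma almost_periodic_orbit_closure:
  assumes f: "almost_periodic (apply_bcontfun f)" and "\<phi> \<in> orbit_closure f"
  shows "almost_periodic (apply_bcontfun \<phi>)"
proof (rule almost_periodic_limit)
  fix e :: real assume "e > 0"
  then obtain h where h: "dist (translate h f) \<phi> < e"
    using assms(2) unfolding orbit_closure_def closure_approachable by blast
  have "norm (apply_bcontfun \<phi> x - apply_bcontfun (translate h f) x) \<le> e" for x
    using norm_diff_le_dist_bcontfun[of \<phi> x "translate h f"] h by (simp add: dist_commute)
  moreover have "almost_periodic (apply_bcontfun (translate h f))"
  proof -
    have "apply_bcontfun (translate h f) = (\<lambda>x. apply_bcontfun f (x + h))" by (simp add: fun_eq_iff)
    then show ?thesis using almost_periodic_translate[OF f, of h] by simp
  qed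
  ultimately show "\<exists>G. almost_periodic G \<and> (\<forall>x. norm (apply_bcontfun \<phi> x - G x) \<le> e)" by blast
qed

lemma continuous_on_orbit_closure_bohr_coeff:
  assumes f: "almost_periodic (apply_bcontfun f)"
  shows "continuous_on (orbit_closure f) (\<lambda>\<phi>. bohr_coeff \<phi> \<xi>)"
proof -
  have "1-lipschitz_on (orbit_closure f) (\<lambda>\<phi>. bohr_coeff \<phi> \<xi>)"
    by (rule lipschitz_onI)
      (simp_all add: dist_norm bohr_coeff_dist_le[unfolded dist_norm] almost_periodic_orbit_closure[OF f])
  then show ?thesis by (rule lipschitz_on_continuous_on)
qed

text \<open>A translation multiplies a Bohr coefficient by a number, so a frequency outside the spectrum of \<open>f\<close>
  is outside the spectrum of every function in the closure of the orbit. Hence only frequencies in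
  the spectrum of \<open>f\<close> are needed to separate points.\<close>

lemma bohr_coeff_orbit_closure_eq_0:
  assumes f: "almost_periodic (apply_bcontfun f)" and "bohr_coeff f \<xi> = 0" and "\<phi> \<in> orbit_closure f"
  shows "bohr_coeff \<phi> \<xi> = 0"
proof (rule continuous_constant_on_closure[of "range (\<lambda>h. translate h f)"])
  show "continuous_on (closure (range (\<lambda>h. translate h f))) (\<lambda>\<phi>. bohr_coeff \<phi> \<xi>)"
    using continuous_on_orbit_closure_bohr_coeff[OF f] by (simp add: orbit_closure_def)
qed (use assms in \<open>auto simp: orbit_closure_def bohr_coeff_translate\<close>)

text \<open>The hypothesis says that \<open>g h\<close> depends on the translate of \<open>f\<close> by \<open>h\<close> only, and does so with
  Lipschitz constant \<open>1\<close>; so \<open>g\<close> becomes a continuous function on the compact closure of the orbit, to which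
  the Stone--Weierstrass theorem applies.\<close>

lemma translation_dominated_trig_approx:
  fixes f :: "(real^'n) \<Rightarrow>\<^sub>C complex" and g :: "real^'n \<Rightarrow> real"
  assumes f: "almost_periodic (apply_bcontfun f)"
    and dom: "\<And>x y. \<bar>g x - g y\<bar> \<le> dist (translate x f) (translate y f)"
    and e: "e > 0"
  shows "\<exists>P\<in>trig_fun (group_closure (bohr_spectrum f)). \<forall>x. norm (of_real (g x) - P x) \<le> e"
proof -
  define M where "M = group_closure (bohr_spectrum f)"
  have M0: "0 \<in> M" and Madd: "\<And>\<xi> \<eta>. \<xi> \<in> M \<Longrightarrow> \<eta> \<in> M \<Longrightarrow> \<xi> + \<eta> \<in> M" and Mminus: "\<And>\<xi>. \<xi> \<in> M \<Longrightarrow> - \<xi> \<in> M"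
    and Mspec: "\<And>\<xi>. bohr_coeff f \<xi> \<noteq> 0 \<Longrightarrow> \<xi> \<in> M"
    by (auto simp: M_def group_closure_add bohr_spectrum_def intro: group_closure.base)
  \<comment> \<open>The algebra is taken as large as the conclusion permits, so that only its closure under sums
    and products and the presence of the Bohr coefficients have to be checked.\<close>
  define A where "A = {r :: ((real^'n) \<Rightarrow>\<^sub>C complex) \<Rightarrow> real.
     continuous_on (orbit_closure f) r \<and> (\<lambda>h. complex_of_real (r (translate h f))) \<in> trig_fun M}"
  have coeff_in_A: "(\<lambda>\<phi>. Re (a * bohr_coeff \<phi> \<xi>)) \<in> A" if "bohr_coeff f \<xi> \<noteq> 0" for a \<xi>
  proof -
    define b where "b = a * bohr_coeff f \<xi> / 2"
    have "complex_of_real (Re (a * bohr_coeff (translate h f) \<xi>)) = b * wave \<xi> h + cnj b * wave (- \<xi>) h" for h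
    proof -
      have Re_eq: "complex_of_real (Re z) = (z + cnj z) / 2" for z by (simp add: complex_add_cnj)
      show ?thesis
        unfolding Re_eq bohr_coeff_translate[OF f] b_def complex_cnj_mult complex_cnj_divide cnj_wave
        by (simp add: field_simps)
    qed
    moreover have "(\<lambda>h. b * wave \<xi> h + cnj b * wave (- \<xi>) h) \<in> trig_fun M"
      using Mspec[OF that] Mminus by (intro trig_fun_add trig_fun_term) auto
    ultimately show ?thesis unfolding A_def
      by (simp add: continuous_on_orbit_closure_bohr_coeff[OF f] continuous_intros)
  qed
  interpret function_ring_on A "orbit_closure f"
  proof
    show "compact (orbit_closure f)" by (rule compact_orbit_closure[OF f])
    show "continuous_on (orbit_closure f) r" if "r \<in> A" for r using that by (simp add: A_def)
    show "(\<lambda>\<phi>. r \<phi> + s \<phi>) \<in> A" if "r \<in> A" "s \<in> A" for r s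
      using that by (auto simp: A_def intro: continuous_intros trig_fun_add)
    show "(\<lambda>\<phi>. r \<phi> * s \<phi>) \<in> A" if "r \<in> A" "s \<in> A" for r s
      using that by (auto simp: A_def intro: continuous_intros trig_fun_mult Madd)
    show "(\<lambda>_. c) \<in> A" for c by (simp add: A_def trig_fun_const M0)
    show "\<exists>r\<in>A. r \<phi> \<noteq> r \<psi>" if \<phi>: "\<phi> \<in> orbit_closure f" and \<psi>: "\<psi> \<in> orbit_closure f" and neq: "\<phi> \<noteq> \<psi>" for \<phi> \<psi>
    proof -
      obtain \<xi> where \<xi>: "bohr_coeff \<phi> \<xi> \<noteq> bohr_coeff \<psi> \<xi>"
        using bohr_coeff_inject[of \<phi> \<psi>] almost_periodic_orbit_closure[OF f] \<phi> \<psi> neq by blast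
      then have nz: "bohr_coeff f \<xi> \<noteq> 0"
        using bohr_coeff_orbit_closure_eq_0[OF f] \<phi> \<psi> by metis
      \<comment> \<open>The factor \<open>- \<i>\<close> turns the imaginary part into a real part.\<close>
      have "Re (1 * bohr_coeff \<phi> \<xi>) \<noteq> Re (1 * bohr_coeff \<psi> \<xi>) \<or>
            Re (- \<i> * bohr_coeff \<phi> \<xi>) \<noteq> Re (- \<i> * bohr_coeff \<psi> \<xi>)"
        using \<xi> by (auto simp: complex_eq_iff)
      then show ?thesis
        by (elim disjE) (rule bexI[OF _ coeff_in_A[OF nz]], assumption)+
    qed
  qed
  \<comment> \<open>Different \<open>h\<close> may give the same translate of \<open>f\<close>; by \<open>dom\<close> the choice of \<open>h\<close> does not affect the
    value.\<close>
  define G where "G \<phi> = g (SOME h. \<phi> = translate h f)" for \<phi>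
  have G: "G (translate h f) = g h" for h
  proof -
    define k where "k = (SOME k. translate h f = translate k f)"
    have "translate h f = translate k f" unfolding k_def by (rule someI) (rule refl)
    then have "dist (translate k f) (translate h f) = 0" by simp
    then have "g k = g h" using dom[of k h] by simp
    then show ?thesis by (simp add: G_def k_def)
  qed
  have "1-lipschitz_on (range (\<lambda>h. translate h f)) G"
    by (rule lipschitz_onI) (auto simp: G dist_real_def dom)
  then have "uniformly_continuous_on (range (\<lambda>h. translate h f)) G" by (rule lipschitz_on_uniformly_continuous)
  then obtain G' where G': "uniformly_continuous_on (orbit_closure f) G'" "\<And>h. G (translate h f) = G' (translate h f)"
    unfolding orbit_closure_def by (rule uniformly_continuous_on_extension_on_closure) (metis rangeI)
  obtain r where r: "r \<in> A" "\<And>\<phi>. \<phi> \<in> orbit_closure f \<Longrightarrow> \<bar>G' \<phi> - r \<phi>\<bar> < e"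
    using Stone_Weierstrass_basic[OF uniformly_continuous_imp_continuous[OF G'(1)] e] by blast
  have "norm (complex_of_real (g x) - of_real (r (translate x f))) \<le> e" for x
    using r(2)[OF translate_in_orbit_closure[of x f]] G'(2)[of x] G[of x] by (simp flip: of_real_diff)
  moreover have "(\<lambda>h. complex_of_real (r (translate h f))) \<in> trig_fun M" using r(1) by (simp add: A_def)
  ultimately show ?thesis unfolding M_def by (intro bexI[of _ "\<lambda>h. complex_of_real (r (translate h f))"]) auto
qed

lemma bohr_spectrum_subset:
  assumes "\<And>e. e > 0 \<Longrightarrow> \<exists>P\<in>trig_fun M. \<forall>x. norm (apply_bcontfun f x - P x) \<le> e"
  shows "bohr_spectrum f \<subseteq> M"
proof
  fix \<xi> assume \<xi>: "\<xi> \<in> bohr_spectrum f"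
  show "\<xi> \<in> M"
  proof (rule ccontr)
    assume nin: "\<xi> \<notin> M"
    have ap: "almost_periodic (apply_bcontfun f)"
      unfolding almost_periodic_def
    proof (intro allI impI)
      fix e :: real assume "e > 0"
      then show "\<exists>P\<in>trig_fun UNIV. \<forall>x. norm (apply_bcontfun f x - P x) \<le> e"
        using assms trig_fun_mono[OF subset_UNIV] by blast
    qed
    have "norm (bohr_coeff f \<xi>) \<le> 0 + e" if "e > 0" for e
    proof -
      obtain P where P: "P \<in> trig_fun M" "\<And>x. norm (apply_bcontfun f x - P x) \<le> e" using assms \<open>e > 0\<close> by blast
      have "norm (bohr_coeff f \<xi> - 0) \<le> e"
      proof (rule has_mean_norm_le[OF _ _ has_mean_diff[OF _ _ bohr_coeff_has_mean[OF ap] trig_fun_coeff_outside[OF nin P(1)]]])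
        show "norm (apply_bcontfun f x * wave (- \<xi>) x - P x * wave (- \<xi>) x) \<le> e" for x
          using P(2)[of x] by (simp add: norm_mult flip: left_diff_distrib)
      qed (intro continuous_intros continuous_on_apply_bcontfun trig_fun_continuous[OF P(1)])+
      then show ?thesis by simp
    qed
    then have "bohr_coeff f \<xi> = 0" using field_le_epsilon[of "norm (bohr_coeff f \<xi>)" 0] by simp
    then show False using \<xi> by (simp add: bohr_spectrum_def)
  qed
qed

section \<open>Almost periodicity of viscosity solutions\<close>

theorem theorem2:
  fixes H :: "real^'n \<Rightarrow> real"
    and u0 :: "(real^'n) \<Rightarrow>\<^sub>C real"
    and u :: "real \<times> (real^'n) \<Rightarrow> real"
  assumes "continuous_on UNIV H"
    and "complexify u0 \<in> AP"
    and "viscosity_solution H (apply_bcontfun u0) u"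
  shows "\<exists>U :: real \<Rightarrow> ((real^'n) \<Rightarrow>\<^sub>C real).
    (\<forall>t\<ge>0. \<forall>x. apply_bcontfun (U t) x = u (t, x)) \<and>
    (\<forall>t\<ge>0. complexify (U t) \<in> AP) \<and>
    continuous_on {0..} (\<lambda>t. complexify (U t)) \<and>
    (\<forall>t>0. bohr_spectrum (complexify (U t)) \<subseteq> group_closure (bohr_spectrum (complexify u0)))"
proof -
  have u: "u \<in> BUC_loc"
    using assms(3) by (simp add: viscosity_solution_def viscosity_subsolution_def)
  define M where "M = group_closure (bohr_spectrum (complexify u0))"
  define U where "U t = Bcontfun (\<lambda>x. u (t, x))" for t
  have U: "apply_bcontfun (U t) x = u (t, x)" if "t \<ge> 0" for t x
    using BUC_loc_slice(1)[OF u that] by (simp add: U_def Bcontfun_inverse)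
  have ap0: "almost_periodic (apply_bcontfun (complexify u0))"
    by (rule AP_imp_almost_periodic[OF assms(2)])
  have dom: "\<bar>u (t, x) - u (t, y)\<bar> \<le> dist (translate x (complexify u0)) (translate y (complexify u0))"
    if "t \<ge> 0" for t x y
  proof -
    \<comment> \<open>Comparing with the translation by \<open>x - y\<close>, and evaluating the two translates of the initial
      function at \<open>z - y\<close>, covers all points \<open>z\<close>.\<close>
    have "\<bar>u (t, y + (x - y)) - u (t, y)\<bar> \<le> dist (translate x (complexify u0)) (translate y (complexify u0))"
    proof (rule viscosity_solution_translation_stable[OF assms(1,3) that])
      fix z
      show "\<bar>apply_bcontfun u0 (z + (x - y)) - apply_bcontfun u0 z\<bar> \<le>
          dist (translate x (complexify u0)) (translate y (complexify u0))"
        using norm_diff_le_dist_bcontfun[of "translate x (complexify u0)" "z - y" "translate y (complexify u0)"]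
        by (simp add: algebra_simps flip: of_real_diff)
    qed
    then show ?thesis by simp
  qed
  have approx: "\<exists>P\<in>trig_fun M. \<forall>x. norm (apply_bcontfun (complexify (U t)) x - P x) \<le> e"
    if "t \<ge> 0" "e > 0" for t e
    using translation_dominated_trig_approx[OF ap0 dom[OF that(1)] that(2)]
    by (simp add: U[OF that(1)] M_def)
  have spectrum: "bohr_spectrum (complexify (U t)) \<subseteq> M" if "t \<ge> 0" for t
    by (rule bohr_spectrum_subset[OF approx[OF that]])
  have AP: "complexify (U t) \<in> AP" if t: "t \<ge> 0" for t
  proof (rule almost_periodic_imp_AP)
    show "almost_periodic (apply_bcontfun (complexify (U t)))"
      unfolding almost_periodic_def using approx[OF t] trig_fun_mono[OF subset_UNIV] by blast
    have "uniformly_continuous_on UNIV (\<lambda>x. complex_of_real (u (t, x)))"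
      by (rule bounded_linear.uniformly_continuous_on[OF bounded_linear_of_real BUC_loc_slice(2)[OF u t]])
    moreover have "apply_bcontfun (complexify (U t)) = (\<lambda>x. complex_of_real (u (t, x)))"
      using U[OF t] by (simp add: fun_eq_iff)
    ultimately show "complexify (U t) \<in> BUC" by (simp add: BUC_def)
  qed
  have "continuous_on {0..} (\<lambda>t. complexify (U t))"
    unfolding continuous_on_iff
  proof (intro ballI allI impI)
    fix t e :: real assume "t \<in> {0..}" and e: "e > 0"
    then have t: "t \<ge> 0" by simp
    obtain r where r: "r > 0" "\<And>z w. z \<in> {0..t + 1} \<times> UNIV \<Longrightarrow> w \<in> {0..t + 1} \<times> UNIV \<Longrightarrow> norm (z - w) < r \<Longrightarrow> \<bar>u z - u w\<bar> < e / 2"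
      using BUC_loc_modulus[OF u, of "t + 1" "e / 2"] t e by auto
    have "dist (complexify (U s)) (complexify (U t)) < e" if s: "s \<in> {0..}" and st: "dist s t < min r 1" for s
    proof -
      have "dist (apply_bcontfun (complexify (U s)) x) (apply_bcontfun (complexify (U t)) x) \<le> e / 2" for x
      proof -
        have "\<bar>u (s, x) - u (t, x)\<bar> < e / 2" using s st t by (intro r(2)) (auto simp: dist_norm)
        then show ?thesis using s t by (simp add: U dist_norm flip: of_real_diff)
      qed
      then have "dist (complexify (U s)) (complexify (U t)) \<le> e / 2" by (rule dist_bound)
      then show ?thesis using e by simp
    qed
    then show "\<exists>d>0. \<forall>s\<in>{0..}. dist s t < d \<longrightarrow> dist (complexify (U s)) (complexify (U t)) < e"
      using r(1) by (intro exI[of _ "min r 1"]) auto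
  qed
  then show ?thesis
    using U AP spectrum by (intro exI[of _ U]) (auto simp: M_def)
qed

end
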